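(* Let $f:\mathbb{R}^d\to\mathbb{R}$ be differentiable with minimum value $f^\star=\min_{x} f(x)$, and $L$-smooth: $\|\nabla f(x)-\nabla f(y)\|\le L\|x-y\|$ for all $x,y\in\mathbb{R}^d$. Let $K\ge1$, $\tau\ge1$ be integers and $M,\sigma^2\ge0$. Let $\{x_t^k\}_{t\ge0}$, $k\in[K]=\{1,\dots,K\}$, be the iterates of local SGD with constant stepsize $\gamma$: $x_0^k=x_0\in\mathbb{R}^d$ for all $k\in[K]$ and, for $t\ge0$, $$x_{t+1}^k=\begin{cases}\frac1K\sum_{j=1}^K\bigl(x_t^j-\gamma g_t^j\bigr)&\text{if }\tau\mid(t+1),\\ x_t^k-\gamma g_t^k&\text{otherwise},\end{cases}\qquad g_t^k=\nabla f(x_t^k)+\xi_t^k,$$ where the noise $\xi_t^k$ is $(M,\sigma^2)$-bounded (see context). Let $T\ge1$ be an integer. Then: (1) If $f$ is $\mu$-quasi-convex with respect to $x^\star$ with $\mu>0$, there exists a stepsize $\gamma\le\frac{1}{10L(\tau K+M)}$ (chosen as in rule A of the context) such that $$\mathbb{E} f(x^{\rm out})-f^\star=\tilde{\mathcal O}\left(L(\tau K+M)\|x_0-x^\star\|^2\exp\left[-\frac{\mu T}{10L(\tau K+M)}\right]+\frac{\sigma^2}{\mu KT}\right),$$ where $x^{\rm out}\in\{x_t^k: 0\le t\le T-1,\ k\in[K]\}$ is chosen to be $x_t^k$ with probability proportional to $(1-\mu\gamma/2)^{-t}$ (uniformly over $k\in[K]$). (2) If $f$ is $\mu$-quasi-convex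 with respect to $x^\star$ with $\mu=0$, there exists a stepsize $\gamma\le\frac{1}{10L(\tau K+M)}$ (chosen as in rule B of the context) such that $$\mathbb{E} f(x^{\rm out})-f^\star=\mathcal O\left(\frac{L(\tau K+M)\|x_0-x^\star\|^2}{T}+\frac{\sigma\|x_0-x^\star\|}{\sqrt{KT}}\right),$$ where $x^{\rm out}$ is chosen uniformly at random from $\{x_t^k: 0\le t\le T-1,\ k\in[K]\}$. (3) If $f$ is an arbitrary (possibly non-convex) such function, there exists a stepsize $\gamma\le\frac{1}{10L(\tau K+M)}$ (chosen as in rule B of the context) such that $$\mathbb{E}\|\nabla f(x^{\rm out})\|^2=\mathcal O\left(\frac{L(\tau K+M)(f(x_0)-f^\star)}{T}+\sigma\sqrt{\frac{L(f(x_0)-f^\star)}{KT}}\right),$$ where $x^{\rm out}$ is chosen uniformly at random from $\{x_t^k: 0\le t\le T-1,\ k\in[K]\}$.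
   Context: $\mu$-quasi-convexity with respect to $x^\star$ ($\mu\ge0$): $f(x)-f^\star+\frac{\mu}{2}\|x-x^\star\|^2\le\langle\nabla f(x),x-x^\star\rangle$ for all $x\in\mathbb{R}^d$ (this forces $x^\star$ to be a minimizer of $f$). $(M,\sigma^2)$-bounded noise: in each gradient $g=\nabla f(x)+\xi$ the noise $\xi$ is conditionally independent (given the query points of the current step, independent of the past of the algorithm and of the noise of the other workers in that step), with $\mathbb{E}[\xi\mid x]=0$ and $\mathbb{E}[\|\xi\|^2\mid x]\le M\|\nabla f(x)\|^2+\sigma^2$. Stepsize rules, with $d=10L(\tau K+M)$. Rule A: $\gamma\le 1/d$ is tuned, depending on the problem parameters and $T$, so as to make $\frac{r_0}{\gamma}\exp[-a\gamma T]+c\gamma$ small, where $a=\mu/2$, $r_0=\|x_0-x^\star\|^2$ and $c$ is a constant multiple of $\sigma^2/K$. Rule B: $\gamma=\sqrt{r_0/(cT)}$ if this is at most $1/d$, and $\gamma=1/d$ otherwise, where in (2) $r_0=\|x_0-x^\star\|^2$ and $c$ is a constant multiple of $\sigma^2/K$, and in (3) $r_0$ is a constant multiple of $f(x_0)-f^\star$ and $c$ a constant multiple of $L\sigma^2/K$. Expectations are over all randomness, including the choice of $x^{\rm out}$. $\mathcal O(\cdot)$ hides constant factors; $\tilde{\mathcal O}(\cdot)$ hides constants and factors polylogarithmic in the problem parameters.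
   Formalization: In (1) the exponent is −(μ/2)T/(10L(τK+M)), not −μT/(10L(τK+M)); the printed rate fails for f(x)=x²/2 on ℝ with L=μ=K=τ=1, M=σ=0, x₀=1, where x^out=x₀ with probability at least 0.95^{T−1}/T. *)

theory Defs
  imports "HOL-Probability.Probability"
begin

text \<open>The gradient is carried as a map \<open>G\<close>, tied to \<open>f\<close> by \<open>GDERIV f x :> G x\<close>.\<close>

definition L_smooth :: "('a::euclidean_space \<Rightarrow> real) \<Rightarrow> ('a \<Rightarrow> 'a) \<Rightarrow> real \<Rightarrow> bool" where
  "L_smooth f G L \<longleftrightarrow>
     (\<forall>x. GDERIV f x :> G x) \<and> (\<forall>x y. norm (G x - G y) \<le> L * norm (x - y))"

definition is_min_value :: "('a \<Rightarrow> real) \<Rightarrow> real \<Rightarrow> bool" where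
  "is_min_value f fstar \<longleftrightarrow> (\<exists>z. f z = fstar) \<and> (\<forall>x. fstar \<le> f x)"

definition quasi_convex ::
  "('a::euclidean_space \<Rightarrow> real) \<Rightarrow> ('a \<Rightarrow> 'a) \<Rightarrow> real \<Rightarrow> real \<Rightarrow> 'a \<Rightarrow> bool" where
  "quasi_convex f G fstar \<mu> xstar \<longleftrightarrow>
     (\<forall>x. f x - fstar + \<mu> / 2 * (norm (x - xstar))\<^sup>2 \<le> G x \<bullet> (x - xstar))"

text \<open>\<open>local_sgd G x0 \<gamma> \<tau> K e t k\<close> is the iterate of worker \<open>k\<close> after \<open>t\<close> steps, for one fixed
  realisation \<open>e s j\<close> of the gradient noise (step \<open>s\<close>, worker \<open>j\<close>).\<close>

primrec local_sgd ::
  "('a::euclidean_space \<Rightarrow> 'a) \<Rightarrow> 'a \<Rightarrow> real \<Rightarrow> nat \<Rightarrow> nat \<Rightarrow> (nat \<Rightarrow> nat \<Rightarrow> 'a) \<Rightarrow> nat \<Rightarrow> nat \<Rightarrow> 'a"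
where
  "local_sgd G x0 \<gamma> \<tau> K e 0 = (\<lambda>k. x0)"
| "local_sgd G x0 \<gamma> \<tau> K e (Suc t) =
     (let x = local_sgd G x0 \<gamma> \<tau> K e t;
          y = (\<lambda>k. x k - \<gamma> *\<^sub>R (G (x k) + e t k))
      in (\<lambda>k. if \<tau> dvd Suc t then (1 / real K) *\<^sub>R (\<Sum>j=1..K. y j) else y k))"

definition generated_algebra :: "'w measure \<Rightarrow> ('w \<Rightarrow> 'a::topological_space) set \<Rightarrow> 'w measure" where
  "generated_algebra P X = sigma (space P) {Y -` A \<inter> space P |Y A. Y \<in> X \<and> A \<in> sets borel}"

definition cond_indep :: "'w measure \<Rightarrow> 'w measure \<Rightarrow> 'w measure \<Rightarrow> 'w measure \<Rightarrow> bool" where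
  "cond_indep P Q A B \<longleftrightarrow>
     (\<forall>a\<in>sets A. \<forall>b\<in>sets B. AE \<omega> in P.
        real_cond_exp P Q (indicator (a \<inter> b)) \<omega> =
        real_cond_exp P Q (indicator a) \<omega> * real_cond_exp P Q (indicator b) \<omega>)"

text \<open>For query points \<open>x t k\<close> and noise \<open>\<xi> t k\<close>. All conditioning in step \<open>t\<close> is on
  the \<open>\<sigma>\<close>-algebra generated by the query points of all workers in that step. The conditional mean
  is taken coordinatewise. Integrability of the noise is not assumed separately: the second-moment
  condition is stated for the extended-nonnegative conditional expectation, and together with the
  Lipschitz gradient it yields square-integrability step by step along the algorithm.\<close>

definition bounded_noise ::
  "'w measure \<Rightarrow> ('a::euclidean_space \<Rightarrow> 'a) \<Rightarrow> real \<Rightarrow> real \<Rightarrow> nat \<Rightarrow>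
   (nat \<Rightarrow> nat \<Rightarrow> 'w \<Rightarrow> 'a) \<Rightarrow> (nat \<Rightarrow> nat \<Rightarrow> 'w \<Rightarrow> 'a) \<Rightarrow> bool" where
  "bounded_noise P G M \<sigma> K x \<xi> \<longleftrightarrow>
     (\<forall>t. \<forall>k\<in>{1..K}. \<xi> t k \<in> borel_measurable P) \<and>
     (\<forall>t. \<forall>k\<in>{1..K}.
        let query = generated_algebra P {x t j |j. j \<in> {1..K}};
            past = {x s j |s j. s \<le> t \<and> j \<in> {1..K}} \<union> {\<xi> s j |s j. s < t \<and> j \<in> {1..K}};
            others = {\<xi> t j |j. j \<in> {1..K} \<and> j \<noteq> k}
        in cond_indep P query (generated_algebra P {\<xi> t k}) (generated_algebra P (past \<union> others)) \<and>
           (\<forall>b\<in>Basis. AE \<omega> in P. real_cond_exp P query (\<lambda>\<omega>. \<xi> t k \<omega> \<bullet> b) \<omega> = 0) \<and>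
           (AE \<omega> in P. nn_cond_exp P query (\<lambda>\<omega>. ennreal ((norm (\<xi> t k \<omega>))\<^sup>2)) \<omega>
                          \<le> ennreal (M * (norm (G (x t k \<omega>)))\<^sup>2 + \<sigma>\<^sup>2)))"

definition local_sgd_noise ::
  "'w measure \<Rightarrow> ('a::euclidean_space \<Rightarrow> 'a) \<Rightarrow> real \<Rightarrow> real \<Rightarrow> 'a \<Rightarrow> real \<Rightarrow> nat \<Rightarrow> nat \<Rightarrow>
   (nat \<Rightarrow> nat \<Rightarrow> 'w \<Rightarrow> 'a) \<Rightarrow> bool" where
  "local_sgd_noise P G M \<sigma> x0 \<gamma> \<tau> K \<xi> \<longleftrightarrow>
     prob_space P \<and>
     bounded_noise P G M \<sigma> K (\<lambda>t k \<omega>. local_sgd G x0 \<gamma> \<tau> K (\<lambda>s j. \<xi> s j \<omega>) t k) \<xi>"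

text \<open>The output is a random variable on the product of the probability space of the noise with
  a probability space of indices \<open>(t, k)\<close>, so that the index is independent of the run.\<close>

definition sgd_output ::
  "('a::euclidean_space \<Rightarrow> 'a) \<Rightarrow> 'a \<Rightarrow> real \<Rightarrow> nat \<Rightarrow> nat \<Rightarrow> (nat \<Rightarrow> nat \<Rightarrow> 'w \<Rightarrow> 'a) \<Rightarrow>
   'w \<times> nat \<times> nat \<Rightarrow> 'a" where
  "sgd_output G x0 \<gamma> \<tau> K \<xi> = (\<lambda>(\<omega>, t, k). local_sgd G x0 \<gamma> \<tau> K (\<lambda>s j. \<xi> s j \<omega>) t k)"

definition uniform_index :: "nat \<Rightarrow> nat \<Rightarrow> (nat \<times> nat) measure" where
  "uniform_index T K = uniform_count_measure ({..<T} \<times> {1..K})"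

definition weighted_index :: "nat \<Rightarrow> nat \<Rightarrow> (nat \<Rightarrow> real) \<Rightarrow> (nat \<times> nat) measure" where
  "weighted_index T K w =
     point_measure ({..<T} \<times> {1..K}) (\<lambda>(t, k). ennreal (w t / (\<Sum>(s, j)\<in>{..<T} \<times> {1..K}. w s)))"

lemma prob_space_uniform_index:
  assumes "T \<ge> 1" "K \<ge> 1" shows "prob_space (uniform_index T K)"
  unfolding uniform_index_def
  by (rule prob_space_uniform_count_measure) (use assms in \<open>auto simp: lessThan_empty_iff\<close>)

lemma prob_space_weighted_index:
  assumes "T \<ge> 1" "K \<ge> 1" "\<And>t. t < T \<Longrightarrow> w t > 0"
  shows "prob_space (weighted_index T K w)"
proof -
  let ?S = "{..<T} \<times> {1..K}" and ?w = "\<lambda>(s, j::nat). w s"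
  have pos: "0 < sum ?w ?S"
    by (rule sum_pos) (use assms in \<open>auto simp: lessThan_empty_iff\<close>)
  have "(\<Sum>p\<in>?S. ?w p / sum ?w ?S) = 1"
    using pos by (simp flip: sum_divide_distrib)
  then have "(\<Sum>p\<in>?S. ennreal (?w p / sum ?w ?S)) = 1"
    by (subst sum_ennreal) (use assms pos less_imp_le in \<open>auto intro!: divide_nonneg_pos\<close>)
  then have "(\<Sum>p\<in>?S. (\<lambda>(t, k). ennreal (w t / sum ?w ?S)) p) = 1"
    by (simp add: case_prod_unfold)
  then show ?thesis
    unfolding weighted_index_def
    by (intro prob_space_point_measure) auto
qed

text \<open>Tuned stepsizes subject to the cap \<open>1 / d\<close>. \<open>stepsize_A\<close> makes \<open>r0 / \<gamma> * exp (- a \<gamma> T) + c \<gamma>\<close>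
  small: up to a constant it is at most \<open>d r0 exp (- a T / d) + (c / (a T)) ln (max 2 (a\<^sup>2 r0 T\<^sup>2 / c))\<close>.
  In both rules \<open>c = 0\<close> is treated separately, because \<open>r0 / c\<close> then stands for infinity, whereas
  division by zero yields zero here.\<close>

definition log_factor :: "real \<Rightarrow> real \<Rightarrow> real \<Rightarrow> nat \<Rightarrow> real" where
  "log_factor a r0 c T = ln (max 2 (a\<^sup>2 * r0 * (real T)\<^sup>2 / c))"

definition stepsize_A :: "real \<Rightarrow> real \<Rightarrow> real \<Rightarrow> real \<Rightarrow> nat \<Rightarrow> real" where
  "stepsize_A d a r0 c T =
     (if c = 0 then 1 / d else min (1 / d) (log_factor a r0 c T / (a * real T)))"

definition stepsize_B :: "real \<Rightarrow> real \<Rightarrow> real \<Rightarrow> nat \<Rightarrow> real" where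
  "stepsize_B d r0 c T =
     (if c \<noteq> 0 \<and> sqrt (r0 / (c * real T)) \<le> 1 / d then sqrt (r0 / (c * real T)) else 1 / d)"

end

theory Submission
  imports Defs
begin

text \<open>Let \<open>m\<close> be the average of the \<open>K\<close> workers. It moves by \<open>- \<gamma> (h + \<zeta>)\<close>, with \<open>h\<close> the average of the
  gradients and \<open>\<zeta>\<close> the average of the noises, whether or not the workers synchronise. The noises of
  different workers are uncorrelated, so the second moment of \<open>\<zeta>\<close> gains a factor \<open>1 / K\<close>. Hence
  \<open>u = E \<parallel>m - x*\<parallel>\<^sup>2\<close> (quasi-convex case) or \<open>u = E f(m) - f*\<close> (general case) decreases in each step up to
  an error proportional to the mean squared deviation \<open>R\<close> of the workers from \<open>m\<close>. As \<open>R\<close> vanishes at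
  every multiple of \<open>\<tau>\<close> and grows by a factor at most \<open>1 + 1 / (2 \<tau>)\<close> in between, apart from new
  gradient and noise terms, the potential \<open>u + C (\<tau> - t mod \<tau>) R\<close> satisfies a clean one-step recursion;
  \<open>\<gamma> \<le> 1 / (10 L (\<tau> K + M))\<close> turns the noise accumulated in \<open>R\<close> into a term of size
  \<open>\<gamma>\<^sup>2 \<sigma>\<^sup>2 / K\<close>. Summing the recursion and inserting the tuned stepsize gives the rates.\<close>

section \<open>Smooth functions\<close>

text \<open>The speed-up \<open>1 / K\<close> concerns only the averaged noise. A single worker
  deviates by a full \<open>\<gamma>\<^sup>2 * \<sigma>\<^sup>2\<close> per step, for up to \<tau>
  steps, and the deviation enters the recursion for \<open>u\<close> with a coefficient of order
  \<open>L * \<gamma>\<close> (distance) or \<open>L\<^sup>2 * \<gamma>\<close> (value). The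
  resulting error is of the order of the averaged noise times
  \<open>L * \<gamma> * \<tau> * K\<close>, so it is harmless once that product is bounded: this is
  the origin of \<open>\<tau> * K\<close>, instead of \<tau>, in the cap. The summand
  \<open>M\<close> lets the part of the noise that scales with the squared gradient be paid by the
  decrease. As all workers query the same \<open>f\<close>, gradient norms need no separate bound:
  they are at most \<open>2 * L * (f x - fstar)\<close> in the quasi-convex case and are themselves
  the decrease in the general case. On the probabilistic side there are two obstacles. Integrability
  of the noise has to be earned by induction along the run. Conditional independence speaks about
  events only, and has to be turned into orthogonality of unbounded vectors.\<close>

lemma smooth_descent:
  assumes "L_smooth f G L"
  shows "f y \<le> f x + G x \<bullet> (y - x) + L / 2 * (norm (y - x))\<^sup>2"
proof -
  define d where "d = y - x"
  \<comment> \<open>\<open>h\<close> is \<open>f\<close> along the segment minus its linearisation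
    and the quadratic correction. The Lipschitz bound makes its derivative nonpositive on the unit
    interval, which replaces integrating the gradient.\<close>
  define h where "h t = f (x + t *\<^sub>R d) - t * (G x \<bullet> d) - L / 2 * t\<^sup>2 * (norm d)\<^sup>2" for t
  have "h 1 \<le> h 0"
  proof (rule DERIV_nonpos_imp_nonincreasing[of 0 1 h])
    fix t :: real assume t: "0 \<le> t" "t \<le> 1"
    have F: "(f has_derivative (\<lambda>v. v \<bullet> G (x + t *\<^sub>R d))) (at (x + t *\<^sub>R d))"
      using assms by (simp add: L_smooth_def gderiv_def)
    have "((\<lambda>t. x + t *\<^sub>R d) has_derivative (\<lambda>s. s *\<^sub>R d)) (at t)"
      by (auto intro!: derivative_eq_intros)
    from has_derivative_compose[OF this F]
    have "((\<lambda>t. f (x + t *\<^sub>R d)) has_real_derivative d \<bullet> G (x + t *\<^sub>R d)) (at t)"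
      by (simp add: has_field_derivative_def mult_commute_abs)
    then have "(h has_real_derivative
        d \<bullet> G (x + t *\<^sub>R d) - G x \<bullet> d - L * t * (norm d)\<^sup>2) (at t)"
      unfolding h_def by (auto intro!: derivative_eq_intros)
    moreover have "d \<bullet> G (x + t *\<^sub>R d) - G x \<bullet> d \<le> L * t * (norm d)\<^sup>2"
    proof -
      have "d \<bullet> G (x + t *\<^sub>R d) - G x \<bullet> d = d \<bullet> (G (x + t *\<^sub>R d) - G x)"
        by (simp add: inner_diff_right inner_commute)
      also have "\<dots> \<le> norm d * norm (G (x + t *\<^sub>R d) - G x)"
        by (rule norm_cauchy_schwarz)
      also have "\<dots> \<le> norm d * (L * norm (x + t *\<^sub>R d - x))"
        using assms unfolding L_smooth_def by (intro mult_left_mono) (blast, simp)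
      finally show ?thesis using t by (simp add: power2_eq_square mult_ac)
    qed
    ultimately show "\<exists>m. (h has_real_derivative m) (at t) \<and> m \<le> 0"
      by (intro exI conjI) auto
  qed simp
  then show ?thesis by (simp add: h_def d_def)
qed

text \<open>A gradient step of length \<open>1 / L\<close> from \<open>x\<close> lowers
  \<open>f\<close> by at least \<open>(norm (G x))\<^sup>2 / (2 * L)\<close>, and the new value is
  still at least \<open>m\<close>.\<close>

lemma smooth_norm_gradient_le:
  assumes "L_smooth f G L" "L > 0" "\<And>y. m \<le> f y"
  shows "(norm (G x))\<^sup>2 \<le> 2 * L * (f x - m)"
proof -
  have "m \<le> f (x - (1 / L) *\<^sub>R G x)" by fact
  also have "\<dots> \<le> f x - (norm (G x))\<^sup>2 / (2 * L)"
    using smooth_descent[OF assms(1), of "x - (1 / L) *\<^sub>R G x" x] \<open>L > 0\<close>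
    by (simp add: power_mult_distrib power2_eq_square dot_square_norm field_simps)
  finally show ?thesis using \<open>L > 0\<close> by (simp add: field_simps)
qed

text \<open>Serves to make \<open>f\<close> of a square-integrable vector integrable. The linear
  term at the origin is split by Young's inequality, and its gradient part is paid by a second copy
  of \<open>f 0 - m\<close>; hence the factor 2.\<close>

lemma smooth_upper_bound:
  assumes "L_smooth f G L" "L > 0" "\<And>y. m \<le> f y"
  shows "f x - m \<le> 2 * (f 0 - m) + L * (norm x)\<^sup>2"
proof -
  have "G 0 \<bullet> x \<le> norm (G 0) * norm x" by (rule norm_cauchy_schwarz)
  also have "\<dots> \<le> (norm (G 0))\<^sup>2 / (2 * L) + L / 2 * (norm x)\<^sup>2"
    using \<open>L > 0\<close> sum_squares_bound[of "norm (G 0)" "L * norm x"]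
    by (simp add: field_simps power2_eq_square)
  also have "(norm (G 0))\<^sup>2 / (2 * L) \<le> f 0 - m"
    using smooth_norm_gradient_le[OF assms, of 0] \<open>L > 0\<close> by (simp add: field_simps)
  finally show ?thesis using smooth_descent[OF assms(1), of x 0] by simp
qed

lemma smooth_continuous:
  assumes "L_smooth f G L"
  shows "continuous_on UNIV f"
  using assms unfolding L_smooth_def gderiv_def
  by (meson continuous_at_imp_continuous_on has_derivative_continuous)

lemma smooth_gradient_continuous:
  assumes "L_smooth f G L" "L > 0"
  shows "continuous_on UNIV G"
proof -
  have "L-lipschitz_on UNIV G"
    using assms by (auto simp: L_smooth_def lipschitz_on_def dist_norm)
  then show ?thesis by (rule lipschitz_on_continuous_on)
qed

text \<open>At distance one from \<open>xs\<close>, quasi-convexity forces a slope of at least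
  \<open>\<mu> / 2\<close>, while the gradient, which vanishes at \<open>xs\<close>, has grown to at
  most \<open>L\<close>. Through this bound the stepsize cap also controls
  \<open>\<mu> * \<gamma>\<close>.\<close>

lemma quasi_convex_modulus_le:
  fixes f :: "'a::euclidean_space \<Rightarrow> real"
  assumes "L_smooth f G L" "L > 0" "\<And>y. m \<le> f y" and qc: "quasi_convex f G m \<mu> xs"
  shows "\<mu> \<le> 2 * L"
proof -
  have fxs: "f xs = m"
    using qc[unfolded quasi_convex_def, rule_format, of xs] assms(3)[of xs] by simp
  then have "G xs = 0"
    using smooth_norm_gradient_le[OF assms(1-3), of xs] by simp
  obtain b :: 'a where b: "b \<in> Basis" using nonempty_Basis by blast
  then have nb: "norm b = 1" by simp
  have "\<mu> / 2 \<le> f (xs + b) - m + \<mu> / 2 * (norm b)\<^sup>2"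
    using assms(3)[of "xs + b"] nb by simp
  also have "\<dots> \<le> G (xs + b) \<bullet> b"
    using qc[unfolded quasi_convex_def, rule_format, of "xs + b"] by simp
  also have "\<dots> \<le> norm (G (xs + b) - G xs) * norm b"
    using \<open>G xs = 0\<close> norm_cauchy_schwarz[of "G (xs + b)" b] by simp
  also have "\<dots> \<le> L * norm (xs + b - xs) * norm b"
    using assms(1) unfolding L_smooth_def by (intro mult_right_mono) (blast, simp)
  finally show ?thesis using nb by simp
qed

section \<open>Averages over the workers\<close>

text \<open>Stated for real vector spaces, so that the same rules serve iterates, gradients, noise
  and real-valued expectations.\<close>

definition avg :: "nat \<Rightarrow> (nat \<Rightarrow> 'b) \<Rightarrow> 'b::real_vector" where
  "avg K z = (1 / real K) *\<^sub>R (\<Sum>j=1..K. z j)"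

lemma avg_add: "avg K (\<lambda>j. x j + y j) = avg K x + avg K y"
  by (simp add: avg_def sum.distrib scaleR_add_right)

lemma avg_diff: "avg K (\<lambda>j. x j - y j) = avg K x - avg K y"
  by (simp add: avg_def sum_subtractf scaleR_diff_right)

lemma avg_scaleR: "avg K (\<lambda>j. c *\<^sub>R x j) = c *\<^sub>R avg K x"
  by (simp add: avg_def scaleR_sum_right[symmetric] mult.commute)

lemma avg_mult: "avg K (\<lambda>j. c * x j) = (c::real) * avg K x"
  using avg_scaleR[of K c x] by simp

lemma avg_const [simp]: "K \<ge> 1 \<Longrightarrow> avg K (\<lambda>_. x) = x"
  by (simp add: avg_def scaleR_conv_of_real sum_constant_scaleR)

lemma avg_mono:
  fixes x y :: "nat \<Rightarrow> real"
  assumes "\<And>j. j \<in> {1..K} \<Longrightarrow> x j \<le> y j"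
  shows "avg K x \<le> avg K y"
  unfolding avg_def using assms by (intro scaleR_left_mono sum_mono) auto

lemma avg_nonneg:
  fixes x :: "nat \<Rightarrow> real"
  assumes "\<And>j. j \<in> {1..K} \<Longrightarrow> 0 \<le> x j"
  shows "0 \<le> avg K x"
  unfolding avg_def using assms by (auto intro!: divide_nonneg_nonneg sum_nonneg)

lemma avg_cong:
  assumes "\<And>j. j \<in> {1..K} \<Longrightarrow> x j = y j"
  shows "avg K x = avg K y"
  unfolding avg_def using assms by (metis (no_types, lifting) sum.cong)

lemma inner_avg_left: "avg K x \<bullet> y = avg K (\<lambda>j. x j \<bullet> y)"
  by (simp add: avg_def inner_sum_left)

lemma inner_avg_right: "y \<bullet> avg K x = avg K (\<lambda>j. y \<bullet> x j)"
  by (simp add: avg_def inner_sum_right)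

text \<open>The variance decomposition. Dropping one of its two nonnegative parts gives either that
  centring does not increase the mean square, or Jensen's inequality for the squared norm.\<close>

lemma avg_variance:
  fixes z :: "nat \<Rightarrow> 'a::real_inner"
  assumes "K \<ge> 1"
  shows "avg K (\<lambda>j. (norm (z j - avg K z))\<^sup>2) = avg K (\<lambda>j. (norm (z j))\<^sup>2) - (norm (avg K z))\<^sup>2"
proof -
  have "avg K (\<lambda>j. (norm (z j - avg K z))\<^sup>2)
    = avg K (\<lambda>j. (norm (z j))\<^sup>2 - 2 * (z j \<bullet> avg K z) + (norm (avg K z))\<^sup>2)"
    by (rule avg_cong) (simp add: power2_norm_eq_inner inner_diff_left inner_diff_right inner_commute)
  also have "\<dots> = avg K (\<lambda>j. (norm (z j))\<^sup>2) - 2 * avg K (\<lambda>j. z j \<bullet> avg K z) + (norm (avg K z))\<^sup>2"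
    using assms by (simp add: avg_add avg_diff avg_mult)
  also have "avg K (\<lambda>j. z j \<bullet> avg K z) = (norm (avg K z))\<^sup>2"
    by (simp add: inner_avg_left[symmetric] power2_norm_eq_inner)
  finally show ?thesis by simp
qed

lemma avg_norm_deviation_le:
  fixes z :: "nat \<Rightarrow> 'a::real_inner"
  assumes "K \<ge> 1"
  shows "avg K (\<lambda>j. (norm (z j - avg K z))\<^sup>2) \<le> avg K (\<lambda>j. (norm (z j))\<^sup>2)"
  using avg_variance[OF assms, of z] by simp

lemma norm_avg_le:
  fixes z :: "nat \<Rightarrow> 'a::real_inner"
  assumes "K \<ge> 1"
  shows "(norm (avg K z))\<^sup>2 \<le> avg K (\<lambda>j. (norm (z j))\<^sup>2)"
  using avg_variance[OF assms, of z] avg_nonneg[of K "\<lambda>j. (norm (z j - avg K z))\<^sup>2"] by simp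

text \<open>Young's inequality, from expanding the square of \<open>\<theta> *\<^sub>R x + y\<close>
  and dividing by \<theta>. A small \<theta> keeps the factor of \<open>x\<close> near one, which is
  what allows the bound to be iterated \<tau> times.\<close>

lemma norm_diff_scaled_le:
  fixes x y :: "'a::real_inner"
  assumes "\<theta> > 0"
  shows "(norm (x - y))\<^sup>2 \<le> (1 + \<theta>) * (norm x)\<^sup>2 + (1 + 1 / \<theta>) * (norm y)\<^sup>2"
proof -
  have "(norm (\<theta> *\<^sub>R x + y))\<^sup>2 = \<theta>\<^sup>2 * (norm x)\<^sup>2 + 2 * \<theta> * (x \<bullet> y) + (norm y)\<^sup>2"
    unfolding power2_norm_eq_inner
    by (simp add: inner_add_left inner_add_right inner_commute power2_eq_square algebra_simps)
  then have "0 \<le> (\<theta>\<^sup>2 * (norm x)\<^sup>2 + 2 * \<theta> * (x \<bullet> y) + (norm y)\<^sup>2) / \<theta>"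
    using assms by (metis divide_nonneg_pos zero_le_power2)
  also have "\<dots> = \<theta> * (norm x)\<^sup>2 + 2 * (x \<bullet> y) + (norm y)\<^sup>2 / \<theta>"
    using assms by (simp add: add_divide_distrib power2_eq_square)
  finally have "0 \<le> \<theta> * (norm x)\<^sup>2 + 2 * (x \<bullet> y) + (norm y)\<^sup>2 / \<theta>" .
  moreover have "(norm (x - y))\<^sup>2 = (norm x)\<^sup>2 - 2 * (x \<bullet> y) + (norm y)\<^sup>2"
    by (simp add: power2_norm_eq_inner inner_diff_left inner_diff_right inner_commute)
  ultimately show ?thesis by (simp add: algebra_simps)
qed

section \<open>Recursions\<close>

text \<open>The deviation \<open>R\<close> is reset at every multiple of \<open>\<tau>\<close>, so a coefficient proportional to the
  number of steps left until the next reset absorbs its growth.\<close>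

lemma potential_step:
  fixes u R C E :: "nat \<Rightarrow> real"
  assumes \<tau>: "\<tau> \<ge> 1" and B: "B \<ge> 0" and \<rho>: "\<rho> \<ge> 1 - 1 / (10 * real \<tau>)"
    and R: "\<And>t. R t \<ge> 0" and E: "E t \<ge> 0"
    and u: "u (Suc t) \<le> \<rho> * u t + B * R t - C t + N"
    and RS: "R (Suc t) \<le> (if \<tau> dvd Suc t then 0 else (1 + 1 / (2 * real \<tau>)) * R t + E t)"
  defines "V \<equiv> \<lambda>t. u t + 5 / 2 * B * real (\<tau> - t mod \<tau>) * R t"
  shows "V (Suc t) \<le> \<rho> * V t - C t + N + 5 / 2 * B * \<tau> * E t"
proof -
  define q where "q = real (\<tau> - t mod \<tau>)"
  have m: "t mod \<tau> < \<tau>" using \<tau> by simp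
  then have q: "1 \<le> q" "q \<le> \<tau>" by (simp_all add: q_def Suc_le_eq of_nat_diff)
  have BR: "0 \<le> B * R t" using B R by simp
  have "1 / (10 * real \<tau>) * q \<le> 1 / (10 * real \<tau>) * \<tau>"
    using q \<tau> by (intro mult_left_mono) auto
  also have "\<dots> = 1 / 10" using \<tau> by simp
  finally have "(1 - 1 / (10 * real \<tau>)) * q \<ge> q - 1 / 10" by (simp add: left_diff_distrib)
  then have \<rho>q: "\<rho> * q \<ge> q - 1 / 10" using \<rho> q by (smt (verit) mult_right_mono)
  have VS: "V (Suc t) \<le> u (Suc t) + 5 / 2 * B * ((q - 1 / 2) * R t + \<tau> * E t)"
  proof (cases "\<tau> dvd Suc t")
    case True
    \<comment> \<open>At a reset the coefficient jumps back up to \<tau>, which costs nothing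
      because it multiplies zero.\<close>
    then have "R (Suc t) = 0" using RS R[of "Suc t"] by simp
    moreover have "0 \<le> (q - 1 / 2) * R t + \<tau> * E t" using q R E by simp
    ultimately show ?thesis using B by (simp add: V_def)
  next
    case False
    then have "Suc (t mod \<tau>) \<noteq> \<tau>" by (metis mod_Suc dvd_eq_mod_eq_0)
    then have S: "Suc t mod \<tau> = Suc (t mod \<tau>)" by (simp add: mod_Suc)
    then have "real (\<tau> - Suc t mod \<tau>) = q - 1"
      using m by (simp add: q_def of_nat_diff Suc_le_eq)
    moreover have "(q - 1) * R (Suc t) \<le> (q - 1 / 2) * R t + \<tau> * E t"
    proof -
      have "(q - 1) * R (Suc t) \<le> (q - 1) * ((1 + 1 / (2 * real \<tau>)) * R t + E t)"
        using RS False q by (intro mult_left_mono) auto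
      also have "\<dots> = ((q - 1) * (1 + 1 / (2 * real \<tau>))) * R t + (q - 1) * E t"
        by (simp add: algebra_simps)
      also have "\<dots> \<le> (q - 1 / 2) * R t + \<tau> * E t"
      proof (intro add_mono mult_right_mono)
        \<comment> \<open>The coefficient falls by one between resets; the growth of
          \<open>R\<close> uses up at most half of this.\<close>
        have "(q - 1) / (2 * real \<tau>) \<le> 1 / 2" using q \<tau> by (simp add: field_simps)
        then show "(q - 1) * (1 + 1 / (2 * real \<tau>)) \<le> q - 1 / 2" by (simp add: algebra_simps)
      qed (use q R E in auto)
      finally show ?thesis .
    qed
    ultimately show ?thesis using B by (simp add: V_def mult.assoc mult_left_mono)
  qed
  \<comment> \<open>Origin of \<open>5 / 2\<close>: of the half unit left over, \<open>2 / 5\<close>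
    must absorb \<open>B * R t\<close>, since \<open>5 / 2 * (2 / 5) = 1\<close>, and the remaining
    \<open>1 / 10\<close> is what the factor \<rho> may take away.\<close>
  have "(q - 1 / 10) * (B * R t) \<le> (\<rho> * q) * (B * R t)"
    using \<rho>q BR by (rule mult_right_mono)
  then show ?thesis using VS u unfolding V_def q_def[symmetric] by (simp add: algebra_simps)
qed

text \<open>The weights satisfy \<open>w (Suc t) * \<rho> = w t\<close>, so multiplying the step at
  \<open>t\<close> by \<open>w t\<close> makes \<open>w t * \<rho> * V t\<close> telescope.\<close>

lemma weighted_sum_bound:
  fixes V F :: "nat \<Rightarrow> real"
  assumes \<rho>: "\<rho> > 0" and V: "\<And>t. V t \<ge> 0"
    and step: "\<And>t. V (Suc t) \<le> \<rho> * V t - \<alpha> * F t + N"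
  defines "w \<equiv> \<lambda>t. \<rho> powi (- int t)"
  shows "\<alpha> * (\<Sum>t<T. w t * F t) \<le> \<rho> * V 0 + N * (\<Sum>t<T. w t)"
proof -
  have w: "w t > 0" for t using \<rho> by (simp add: w_def)
  have wS: "w (Suc t) * \<rho> = w t" for t
    using \<rho> by (simp add: w_def power_int_minus field_simps)
  have "\<alpha> * (\<Sum>t<T. w t * F t) + w T * \<rho> * V T \<le> \<rho> * V 0 + N * (\<Sum>t<T. w t)"
  proof (induction T)
    case 0
    then show ?case by (simp add: w_def)
  next
    case (Suc T)
    have "w T * V (Suc T) \<le> w T * (\<rho> * V T - \<alpha> * F T + N)"
      using step w by (intro mult_left_mono) (auto intro: less_imp_le)
    then show ?case using Suc wS[of T] by (simp add: algebra_simps)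
  qed
  moreover have "0 \<le> w T * \<rho> * V T" using w[of T] \<rho> V[of T] by simp
  ultimately show ?thesis by linarith
qed

text \<open>Of the total weight only the last and largest summand \<open>w (T - 1)\<close> is kept.
  It turns the factor of \<open>V 0\<close> into \<open>\<rho> ^ T\<close>, which is bounded by the
  exponential.\<close>

lemma weighted_average_bound:
  fixes V F :: "nat \<Rightarrow> real"
  assumes \<rho>: "0 < \<rho>" "\<rho> \<le> 1" and V: "\<And>t. V t \<ge> 0" and \<alpha>: "\<alpha> > 0" and T: "T \<ge> 1"
    and step: "\<And>t. V (Suc t) \<le> \<rho> * V t - \<alpha> * F t + N"
  defines "w \<equiv> \<lambda>t. \<rho> powi (- int t)"
  shows "(\<Sum>t<T. w t * F t) / (\<Sum>t<T. w t) \<le> (V 0 * exp (- (1 - \<rho>) * T) + N) / \<alpha>"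
proof -
  define W where "W = (\<Sum>t<T. w t)"
  have w: "w t > 0" for t using \<rho> by (simp add: w_def)
  have "w (T - 1) \<le> W"
    unfolding W_def using T w by (intro member_le_sum) (auto intro: less_imp_le)
  moreover have "\<rho> / w (T - 1) = \<rho> ^ T"
    using \<rho> T by (cases T) (simp_all add: w_def power_int_minus divide_inverse)
  moreover have W: "W > 0" using \<open>w (T - 1) \<le> W\<close> w[of "T - 1"] by simp
  ultimately have "\<rho> / W \<le> \<rho> ^ T"
    using \<rho> w[of "T - 1"] by (metis divide_left_mono mult_pos_pos less_imp_le)
  also have "\<dots> \<le> exp (- (1 - \<rho>)) ^ T"
    using \<rho> exp_ge_add_one_self[of "- (1 - \<rho>)"] by (intro power_mono) auto
  also have "\<dots> = exp (- (1 - \<rho>) * T)" by (simp add: exp_of_nat_mult[symmetric] mult.commute)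
  finally have "V 0 * (\<rho> / W) \<le> V 0 * exp (- (1 - \<rho>) * T)" using V by (intro mult_left_mono)
  moreover have "\<alpha> * (\<Sum>t<T. w t * F t) / W \<le> (\<rho> * V 0 + N * W) / W"
    using weighted_sum_bound[where V=V and \<rho>=\<rho> and \<alpha>=\<alpha> and F=F and N=N and T=T] \<rho> V step W
    unfolding w_def W_def by (intro divide_right_mono) auto
  ultimately have "\<alpha> * (\<Sum>t<T. w t * F t) / W \<le> V 0 * exp (- (1 - \<rho>) * T) + N"
    using W by (simp add: add_divide_distrib mult.commute)
  then show ?thesis using \<alpha> unfolding W_def by (simp add: field_simps)
qed

section \<open>Tuned stepsizes\<close>

text \<open>If the cap is active, the exponential term is the first summand. Otherwise
  \<open>\<gamma> = l / (a * T)\<close> with \<open>l\<close> the log factor, and the exponential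
  equals \<open>exp (- l)\<close>, small enough to bring \<open>r0 / \<gamma>\<close> down to the
  order of \<open>c / (a * T)\<close>.\<close>

lemma stepsize_A_bounds:
  assumes d: "d > 0" and a: "a > 0" and r0: "r0 \<ge> 0" and c: "c \<ge> 0" and T: "T \<ge> 1"
  defines "\<gamma> \<equiv> stepsize_A d a r0 c T"
  shows "0 < \<gamma>" "\<gamma> \<le> 1 / d"
    "c * \<gamma> \<le> log_factor a r0 c T * (c / (a * T))"
    "r0 / \<gamma> * exp (- a * \<gamma> * T)
       \<le> d * r0 * exp (- (a * T / d)) + 9 / 4 * (log_factor a r0 c T * (c / (a * T)))"
proof -
  define l where "l = log_factor a r0 c T"
  have "ln 2 \<le> l" unfolding l_def log_factor_def by simp
  \<comment> \<open>The \<open>max 2\<close> inside the logarithm keeps \<open>l\<close> away from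
    zero, so that \<open>1 / l\<close> below can be bounded by a multiple of
    \<open>l\<close>.\<close>
  then have l: "2 / 3 \<le> l" using ln2_ge_two_thirds by simp
  have aT: "a * T > 0" using a T by simp
  show \<gamma>: "0 < \<gamma>" "\<gamma> \<le> 1 / d"
    using d l aT a T by (auto simp: \<gamma>_def stepsize_A_def l_def[symmetric])
  have lc: "0 \<le> l * (c / (a * T))" using l c aT a by (intro mult_nonneg_nonneg divide_nonneg_nonneg) auto
  show "c * \<gamma> \<le> log_factor a r0 c T * (c / (a * T))"
  proof (cases "c = 0")
    case False
    then have "c * \<gamma> \<le> c * (l / (a * T))"
      using c by (intro mult_left_mono) (auto simp: \<gamma>_def stepsize_A_def l_def)
    then show ?thesis by (simp add: l_def mult_ac)
  qed simp
  show "r0 / \<gamma> * exp (- a * \<gamma> * T)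
       \<le> d * r0 * exp (- (a * T / d)) + 9 / 4 * (log_factor a r0 c T * (c / (a * T)))"
  proof (cases "\<gamma> = 1 / d")
    case True
    then have "r0 / \<gamma> * exp (- a * \<gamma> * T) = d * r0 * exp (- (a * T / d))" by simp
    moreover have "0 \<le> 9 / 4 * (log_factor a r0 c T * (c / (a * T)))"
      using lc unfolding l_def by (intro mult_nonneg_nonneg[of "9 / 4"]) simp_all
    ultimately show ?thesis by linarith
  next
    case False
    then have \<gamma>eq: "\<gamma> = l / (a * T)" and c0: "c > 0"
      using c by (auto simp: \<gamma>_def stepsize_A_def l_def min_def split: if_splits)
    define m where "m = max 2 (a\<^sup>2 * r0 * (real T)\<^sup>2 / c)"
    have m: "m > 0" "a\<^sup>2 * r0 * (real T)\<^sup>2 / c \<le> m" unfolding m_def by auto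
    have "exp l = m" unfolding l_def log_factor_def m_def[symmetric] using m by simp
    then have e: "exp (- a * \<gamma> * T) = 1 / m"
      using aT a T by (simp add: \<gamma>eq exp_minus field_simps)
    have r: "r0 * (a * T) / m \<le> c / (a * T)"
      using m c0 aT by (simp add: field_simps power2_eq_square)
    have "r0 / \<gamma> * exp (- a * \<gamma> * T) = (r0 * (a * T) / m) * (1 / l)"
      using e by (simp add: \<gamma>eq)
    also have "\<dots> \<le> c / (a * T) * (9 / 4 * l)"
    proof (rule mult_mono[OF r])
      \<comment> \<open>The factor \<open>9 / 4\<close> is the square of \<open>3 / 2\<close>:
        \<open>1 \<le> (3 / 2 * l)\<^sup>2\<close>, divided by \<open>l\<close>.\<close>
      have "1 \<le> 3 / 2 * l" using l by simp
      then have "1 * 1 \<le> (3 / 2 * l) * (3 / 2 * l)" by (intro mult_mono) auto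
      then show "1 / l \<le> 9 / 4 * l" using l by (simp add: field_simps)
    qed (use l c0 aT a in auto)
    also have "\<dots> \<le> d * r0 * exp (- (a * T / d)) + c / (a * T) * (9 / 4 * l)"
      using d r0 by simp
    finally show ?thesis by (simp add: l_def mult_ac)
  qed
qed

text \<open>The value \<open>s\<close> balances the two error terms: \<open>c * s\<close> and
  \<open>r0 / (s * T)\<close> both equal \<open>sqrt (r0 * c / T)\<close>. When the cap is active,
  \<open>r0 / (\<gamma> * T)\<close> becomes \<open>d * r0 / T\<close>, and for
  \<open>c \<noteq> 0\<close> the cap lies below \<open>s\<close>. The stepsize can vanish, but only
  with \<open>r0\<close>.\<close>

lemma stepsize_B_bounds:
  assumes d: "d > 0" and r0: "r0 \<ge> 0" and c: "c \<ge> 0" and T: "T \<ge> 1"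
  defines "\<gamma> \<equiv> stepsize_B d r0 c T"
  shows "0 \<le> \<gamma>" "\<gamma> \<le> 1 / d" "\<gamma> = 0 \<Longrightarrow> r0 = 0"
    "c * \<gamma> \<le> sqrt (r0 * c / T)"
    "r0 / (\<gamma> * T) \<le> d * r0 / T + sqrt (r0 * c / T)"
proof -
  define s where "s = sqrt (r0 / (c * real T))"
  have s0: "s \<ge> 0" using r0 c by (simp add: s_def)
  have \<gamma>: "\<gamma> = (if c \<noteq> 0 \<and> s \<le> 1 / d then s else 1 / d)"
    by (simp add: \<gamma>_def stepsize_B_def s_def)
  show "0 \<le> \<gamma>" "\<gamma> \<le> 1 / d" using d s0 by (auto simp: \<gamma>)
  show "\<gamma> = 0 \<Longrightarrow> r0 = 0" using d T by (auto simp: \<gamma> s_def split: if_splits)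
  have cs: "c * s = sqrt (r0 * c / T)"
  proof (cases "c = 0")
    case False
    then have "c * s = sqrt (c\<^sup>2) * s" using c by simp
    also have "\<dots> = sqrt (c\<^sup>2 * (r0 / (c * real T)))" by (simp only: s_def real_sqrt_mult)
    also have "c\<^sup>2 * (r0 / (c * real T)) = r0 * c / T" using False by (simp add: power2_eq_square)
    finally show ?thesis .
  qed simp
  show "c * \<gamma> \<le> sqrt (r0 * c / T)"
  proof (cases "c = 0")
    case False
    then have "\<gamma> \<le> s" by (simp add: \<gamma>)
    then show ?thesis using cs c by (metis mult_left_mono)
  qed simp
  show "r0 / (\<gamma> * T) \<le> d * r0 / T + sqrt (r0 * c / T)"
  proof (cases "\<gamma> = 1 / d")
    case True
    then show ?thesis using r0 c by (simp add: mult_ac)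
  next
    case False
    then have \<gamma>s: "\<gamma> = s" "c > 0" using c by (auto simp: \<gamma> split: if_splits)
    have "r0 / (s * T) = c * s"
    \<comment> \<open>For \<open>s = 0\<close> both sides are zero, the left one by the convention
      for division by zero.\<close>
    proof (cases "s = 0")
      case False
      have "c * s * (s * T) = c * T * s\<^sup>2" by (simp add: power2_eq_square)
      also have "s\<^sup>2 = r0 / (c * T)" using r0 c by (simp add: s_def)
      finally show ?thesis using False T \<gamma>s by (simp add: field_simps)
    qed simp
    then show ?thesis using \<gamma>s cs d r0 by simp
  qed
qed

section \<open>Square-integrable random vectors\<close>

text \<open>Measurability of \<open>X\<close> is included because it does not follow from
  integrability of its squared norm.\<close>

definition sq_int :: "'w measure \<Rightarrow> ('w \<Rightarrow> 'a::euclidean_space) \<Rightarrow> bool" where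
  "sq_int P X \<longleftrightarrow> X \<in> borel_measurable P \<and> integrable P (\<lambda>\<omega>. (norm (X \<omega>))\<^sup>2)"

lemma sq_int_measurable: "sq_int P X \<Longrightarrow> X \<in> borel_measurable P"
  by (simp add: sq_int_def)

lemma sq_int_integrable: "sq_int P X \<Longrightarrow> integrable P (\<lambda>\<omega>. (norm (X \<omega>))\<^sup>2)"
  by (simp add: sq_int_def)

lemma sq_int_bound:
  assumes "integrable P g" "X \<in> borel_measurable P" "\<And>\<omega>. (norm (X \<omega>))\<^sup>2 \<le> g \<omega>"
  shows "sq_int P X"
proof -
  have [measurable]: "X \<in> borel_measurable P" by fact
  have "norm ((norm (X \<omega>))\<^sup>2) \<le> norm (g \<omega>)" for \<omega> using assms(3)[of \<omega>] by simp
  then have "integrable P (\<lambda>\<omega>. (norm (X \<omega>))\<^sup>2)"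
    by (intro Bochner_Integration.integrable_bound[OF assms(1)]) auto
  then show ?thesis using assms by (simp add: sq_int_def)
qed

lemma sq_int_diff:
  assumes "sq_int P X" "sq_int P Y"
  shows "sq_int P (\<lambda>\<omega>. X \<omega> - Y \<omega>)"
proof (rule sq_int_bound)
  show "integrable P (\<lambda>\<omega>. 2 * (norm (X \<omega>))\<^sup>2 + 2 * (norm (Y \<omega>))\<^sup>2)"
    using assms by (auto simp: sq_int_def)
  show "(\<lambda>\<omega>. X \<omega> - Y \<omega>) \<in> borel_measurable P"
    using assms by (auto simp: sq_int_def)
  show "(norm (X \<omega> - Y \<omega>))\<^sup>2 \<le> 2 * (norm (X \<omega>))\<^sup>2 + 2 * (norm (Y \<omega>))\<^sup>2" for \<omega>
    using norm_diff_scaled_le[of 1 "X \<omega>" "Y \<omega>"] by simp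
qed

lemma sq_int_scaleR:
  assumes "sq_int P X"
  shows "sq_int P (\<lambda>\<omega>. c *\<^sub>R X \<omega>)"
  using assms by (auto simp: sq_int_def power_mult_distrib)

lemma (in finite_measure) sq_int_const: "sq_int M (\<lambda>_. c)"
  by (simp add: sq_int_def)

lemma sq_int_add:
  assumes "sq_int P X" "sq_int P Y"
  shows "sq_int P (\<lambda>\<omega>. X \<omega> + Y \<omega>)"
  using sq_int_diff[OF assms(1) sq_int_scaleR[OF assms(2), of "-1"]] by simp

lemma (in finite_measure) sq_int_sum:
  assumes "\<And>j. j \<in> I \<Longrightarrow> sq_int M (X j)"
  shows "sq_int M (\<lambda>\<omega>. \<Sum>j\<in>I. X j \<omega>)"
  using assms by (induction I rule: infinite_finite_induct) (auto intro: sq_int_const sq_int_add)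

lemma (in finite_measure) sq_int_avg:
  assumes "\<And>j. j \<in> {1..K} \<Longrightarrow> sq_int M (X j)"
  shows "sq_int M (\<lambda>\<omega>. avg K (\<lambda>j. X j \<omega>))"
  unfolding avg_def using assms by (intro sq_int_scaleR sq_int_sum)

text \<open>Only the increment from \<open>G 0\<close> is controlled by
  \<open>L * norm (X \<omega>)\<close>; the constant is added back using that the measure is
  finite.\<close>

lemma (in finite_measure) sq_int_lipschitz:
  assumes X: "sq_int M X" and G: "continuous_on UNIV G" "\<And>x y. norm (G x - G y) \<le> L * norm (x - y)"
  shows "sq_int M (\<lambda>\<omega>. G (X \<omega>))"
proof -
  have [measurable]: "X \<in> borel_measurable M" using X by (rule sq_int_measurable)
  have [measurable]: "G \<in> borel_measurable borel" using G(1) by (rule borel_measurable_continuous_onI)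
  have "sq_int M (\<lambda>\<omega>. G (X \<omega>) - G 0)"
  proof (rule sq_int_bound)
    show "integrable M (\<lambda>\<omega>. L\<^sup>2 * (norm (X \<omega>))\<^sup>2)" using X by (simp add: sq_int_def)
    show "(norm (G (X \<omega>) - G 0))\<^sup>2 \<le> L\<^sup>2 * (norm (X \<omega>))\<^sup>2" for \<omega>
      using power_mono[OF G(2)[of "X \<omega>" 0], of 2] by (simp add: power_mult_distrib)
  qed measurable
  from sq_int_add[OF this sq_int_const[of "G 0"]] show ?thesis by simp
qed

lemma sq_int_inner:
  assumes "sq_int P X" "sq_int P Y"
  shows "integrable P (\<lambda>\<omega>. X \<omega> \<bullet> Y \<omega>)"
proof (rule Bochner_Integration.integrable_bound)
  show "integrable P (\<lambda>\<omega>. (norm (X \<omega>))\<^sup>2 + (norm (Y \<omega>))\<^sup>2)"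
    using assms by (auto simp: sq_int_def)
  show "(\<lambda>\<omega>. X \<omega> \<bullet> Y \<omega>) \<in> borel_measurable P"
    using assms by (auto simp: sq_int_def)
  have "\<bar>X \<omega> \<bullet> Y \<omega>\<bar> \<le> (norm (X \<omega>))\<^sup>2 + (norm (Y \<omega>))\<^sup>2" for \<omega>
  proof -
    have "\<bar>X \<omega> \<bullet> Y \<omega>\<bar> \<le> norm (X \<omega>) * norm (Y \<omega>)" by (rule Cauchy_Schwarz_ineq2)
    also have "\<dots> \<le> 2 * norm (X \<omega>) * norm (Y \<omega>)" by simp
    also have "\<dots> \<le> (norm (X \<omega>))\<^sup>2 + (norm (Y \<omega>))\<^sup>2" by (rule sum_squares_bound)
    finally show ?thesis .
  qed
  then show "AE \<omega> in P. norm (X \<omega> \<bullet> Y \<omega>) \<le> norm ((norm (X \<omega>))\<^sup>2 + (norm (Y \<omega>))\<^sup>2)" by simp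
qed

lemma sq_int_component:
  assumes "sq_int P X" "b \<in> Basis"
  shows "sq_int P (\<lambda>\<omega>. X \<omega> \<bullet> b)"
proof (rule sq_int_bound)
  show "integrable P (\<lambda>\<omega>. (norm (X \<omega>))\<^sup>2)" using assms by (simp add: sq_int_def)
  show "(\<lambda>\<omega>. X \<omega> \<bullet> b) \<in> borel_measurable P" using assms by (auto simp: sq_int_def)
  show "(norm (X \<omega> \<bullet> b))\<^sup>2 \<le> (norm (X \<omega>))\<^sup>2" for \<omega>
    using Basis_le_norm[OF assms(2), of "X \<omega>"] by (simp add: abs_le_square_iff[symmetric])
qed

lemma (in finite_measure) sq_int_real_integrable:
  fixes X :: "'a \<Rightarrow> real"
  assumes "sq_int M X"
  shows "integrable M X"
  using sq_int_inner[OF assms sq_int_const[of 1]] by simp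

lemma integrable_avg:
  fixes z :: "nat \<Rightarrow> 'w \<Rightarrow> real"
  assumes "\<And>j. j \<in> {1..K} \<Longrightarrow> integrable P (z j)"
  shows "integrable P (\<lambda>\<omega>. avg K (\<lambda>j. z j \<omega>))"
    and "(\<integral>\<omega>. avg K (\<lambda>j. z j \<omega>) \<partial>P) = avg K (\<lambda>j. \<integral>\<omega>. z j \<omega> \<partial>P)"
proof -
  have "integrable P (\<lambda>\<omega>. \<Sum>j=1..K. z j \<omega>)"
    using assms by (rule Bochner_Integration.integrable_sum)
  then show "integrable P (\<lambda>\<omega>. avg K (\<lambda>j. z j \<omega>))" unfolding avg_def by simp
  have "(\<integral>\<omega>. (\<Sum>j=1..K. z j \<omega>) \<partial>P) = (\<Sum>j=1..K. \<integral>\<omega>. z j \<omega> \<partial>P)"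
    using assms by (rule Bochner_Integration.integral_sum)
  then show "(\<integral>\<omega>. avg K (\<lambda>j. z j \<omega>) \<partial>P) = avg K (\<lambda>j. \<integral>\<omega>. z j \<omega> \<partial>P)"
    unfolding avg_def by simp
qed

section \<open>Conditional expectations\<close>

lemma subalgebra_generated:
  assumes "\<And>Y. Y \<in> X \<Longrightarrow> Y \<in> borel_measurable P"
  shows "subalgebra P (generated_algebra P X)"
proof -
  have "{Y -` A \<inter> space P |Y A. Y \<in> X \<and> A \<in> sets borel} \<subseteq> sets P"
    using assms by (auto intro: measurable_sets)
  then show ?thesis
    unfolding subalgebra_def generated_algebra_def
    by (auto simp: sets.sigma_sets_subset sets_measure_of_conv space_measure_of_conv)
qed

lemma measurable_generated:
  assumes "Y \<in> X"
  shows "Y \<in> borel_measurable (generated_algebra P X)"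
proof (rule measurableI)
  fix A :: "'b set" assume "A \<in> sets borel"
  then show "Y -` A \<inter> space (generated_algebra P X) \<in> sets (generated_algebra P X)"
    unfolding generated_algebra_def using assms
    by (auto simp: sets_measure_of_conv space_measure_of_conv intro!: sigma_sets.Basic)
qed simp

lemma (in prob_space) subalgebra_sigma_finite:
  "subalgebra M F \<Longrightarrow> sigma_finite_subalgebra M F"
  by (intro finite_measure_subalgebra_is_sigma_finite)
    (simp add: finite_measure_subalgebra_def finite_measure_subalgebra_axioms_def finite_measure_axioms)

text \<open>The factor \<open>f\<close> is pulled through the conditional expectation, which leaves
  \<open>f\<close> times zero.\<close>

lemma (in sigma_finite_subalgebra) integral_mult_eq_0:
  assumes "integrable M (\<lambda>x. f x * g x)" "f \<in> borel_measurable F" "g \<in> borel_measurable M"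
    and "AE x in M. real_cond_exp M F g x = 0"
  shows "(\<integral>x. f x * g x \<partial>M) = 0"
proof -
  have "(\<integral>x. f x * g x \<partial>M) = (\<integral>x. f x * real_cond_exp M F g x \<partial>M)"
    using real_cond_exp_intg(2)[OF assms(1-3)] by simp
  also have "\<dots> = (\<integral>x. 0 \<partial>M)"
    using assms(4) measurable_from_subalg[OF subalg assms(2)]
    by (intro integral_cong_AE) auto
  finally show ?thesis by simp
qed

text \<open>Conditional independence makes the indicator of \<open>c\<close> and its conditional expectation given
  \<open>Q\<close> indistinguishable by \<open>A\<close>-measurable functions, so a mean-zero property given \<open>Q\<close> carries over
  to \<open>B\<close>.\<close>

lemma (in prob_space) integral_mult_cond_indep_eq_0:
  assumes Q: "subalgebra M Q" and A: "subalgebra M A" and B: "subalgebra M B"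
    and ci: "cond_indep M Q A B"
    and X: "X \<in> borel_measurable A" "integrable M X" and Y: "Y \<in> borel_measurable B"
    and XY: "integrable M (\<lambda>\<omega>. X \<omega> * Y \<omega>)"
    and zero: "AE \<omega> in M. real_cond_exp M Q X \<omega> = 0"
  shows "(\<integral>\<omega>. X \<omega> * Y \<omega> \<partial>M) = 0"
proof -
  interpret Q: sigma_finite_subalgebra M Q using Q by (rule subalgebra_sigma_finite)
  interpret A: sigma_finite_subalgebra M A using A by (rule subalgebra_sigma_finite)
  interpret B: sigma_finite_subalgebra M B using B by (rule subalgebra_sigma_finite)
  have [measurable]: "X \<in> borel_measurable M" using X by auto
  \<comment> \<open>Testing \<open>X\<close> against events of \<open>B\<close> suffices: it
    identifies the conditional expectation of \<open>X\<close> given \<open>B\<close> as zero, from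
    which the unbounded factor \<open>Y\<close> can be treated afterwards.\<close>
  have "(\<integral>\<omega>. X \<omega> * indicator c \<omega> \<partial>M) = 0" if c: "c \<in> sets B" for c
  proof -
    have [measurable]: "c \<in> sets M" using c B by (auto simp: subalgebra_def)
    define h where "h = real_cond_exp M Q (indicator c)"
    have hQ: "h \<in> borel_measurable Q" by (simp add: h_def)
    have [measurable]: "h \<in> borel_measurable M" by (simp add: h_def)
    have ic: "integrable M (indicator c :: _ \<Rightarrow> real)" by (simp add: integrable_indicator_iff emeasure_eq_measure)
    have ih: "integrable M h" unfolding h_def using ic by (rule Q.real_cond_exp_int)
    have "AE \<omega> in M. 0 \<le> h \<omega>" unfolding h_def by (rule Q.real_cond_exp_pos) auto
    moreover have "AE \<omega> in M. h \<omega> \<le> real_cond_exp M Q (\<lambda>_. 1) \<omega>"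
      unfolding h_def by (rule Q.real_cond_exp_mono) (auto simp: ic indicator_def)
    \<comment> \<open>\<open>h\<close> takes values between 0 and 1 almost everywhere, so
      \<open>X * h\<close> inherits integrability from \<open>X\<close>.\<close>
    moreover have "AE \<omega> in M. real_cond_exp M Q (\<lambda>_. 1) \<omega> = 1"
      by (rule Q.real_cond_exp_F_meas) auto
    ultimately have hb: "AE \<omega> in M. \<bar>h \<omega>\<bar> \<le> 1" by eventually_elim auto
    have iXh: "integrable M (\<lambda>\<omega>. X \<omega> * h \<omega>)"
    proof (rule Bochner_Integration.integrable_bound[OF X(2)])
      show "AE \<omega> in M. norm (X \<omega> * h \<omega>) \<le> norm (X \<omega>)"
        using hb by eventually_elim (simp add: abs_mult mult_left_le)
    qed measurable
    have iXc: "integrable M (\<lambda>\<omega>. X \<omega> * indicator c \<omega>)"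
      using integrable_mult_indicator[OF _ X(2), of c] by (simp add: mult.commute)
    \<comment> \<open>Projecting onto \<open>A\<close> avoids approximating the unbounded
      \<open>X\<close> by simple functions: it is enough to compare \<open>c\<close> and
      \<open>h\<close> on events of \<open>A\<close>, where conditional independence applies
      directly.\<close>
    have "AE \<omega> in M. real_cond_exp M A (indicator c) \<omega> = real_cond_exp M A h \<omega>"
    proof (rule A.real_cond_exp_charact)
      fix a assume a: "a \<in> sets A"
      have [measurable]: "a \<in> sets M" using a A by (auto simp: subalgebra_def)
      have ia: "integrable M (\<lambda>\<omega>. h \<omega> * indicator a \<omega>)"
        using integrable_mult_indicator[OF _ ih, of a] by (simp add: mult.commute)
      have "(\<integral>\<omega>\<in>a. indicator c \<omega> \<partial>M) = (\<integral>\<omega>. indicat_real (a \<inter> c) \<omega> \<partial>M)"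
        by (simp add: set_lebesgue_integral_def indicator_inter_arith)
      also have "\<dots> = (\<integral>\<omega>. real_cond_exp M Q (indicator (a \<inter> c)) \<omega> \<partial>M)"
        by (intro Q.real_cond_exp_int(2)[symmetric]) (simp add: integrable_indicator_iff emeasure_eq_measure)
      also have "\<dots> = (\<integral>\<omega>. h \<omega> * real_cond_exp M Q (indicator a) \<omega> \<partial>M)"
        using ci a c unfolding cond_indep_def h_def
        by (intro integral_cong_AE) (auto simp: mult.commute)
      also have "\<dots> = (\<integral>\<omega>. h \<omega> * indicator a \<omega> \<partial>M)"
        using ia hQ by (intro Q.real_cond_exp_intg(2)) auto
      also have "\<dots> = (\<integral>\<omega>\<in>a. h \<omega> \<partial>M)"
        by (simp add: set_lebesgue_integral_def mult.commute)
      also have "\<dots> = (\<integral>\<omega>\<in>a. real_cond_exp M A h \<omega> \<partial>M)"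
        using ih a by (rule A.real_cond_exp_intA)
      finally show "(\<integral>\<omega>\<in>a. indicator c \<omega> \<partial>M) = (\<integral>\<omega>\<in>a. real_cond_exp M A h \<omega> \<partial>M)" .
    qed (use ic ih A.real_cond_exp_int in auto)
    then have "(\<integral>\<omega>. X \<omega> * real_cond_exp M A (indicator c) \<omega> \<partial>M)
        = (\<integral>\<omega>. X \<omega> * real_cond_exp M A h \<omega> \<partial>M)"
      by (intro integral_cong_AE) auto
    \<comment> \<open>The event \<open>c\<close> may now be replaced by the
      \<open>Q\<close>-measurable \<open>h\<close>, against which \<open>X\<close> integrates to
      zero.\<close>
    then have "(\<integral>\<omega>. X \<omega> * indicator c \<omega> \<partial>M) = (\<integral>\<omega>. X \<omega> * h \<omega> \<partial>M)"
      using A.real_cond_exp_intg(2)[OF iXc X(1)] A.real_cond_exp_intg(2)[OF iXh X(1)] by simp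
    also have "\<dots> = (\<integral>\<omega>. h \<omega> * X \<omega> \<partial>M)" by (simp add: mult.commute)
    also have "\<dots> = 0"
      using iXh hQ zero by (intro Q.integral_mult_eq_0) (auto simp: mult.commute)
    finally show ?thesis .
  qed
  then have "AE \<omega> in M. real_cond_exp M B X \<omega> = 0"
    using X(2) by (intro B.real_cond_exp_charact) (auto simp: set_lebesgue_integral_def mult.commute)
  then have "(\<integral>\<omega>. Y \<omega> * X \<omega> \<partial>M) = 0"
    using XY Y by (intro B.integral_mult_eq_0) (auto simp: mult.commute)
  then show ?thesis by (simp add: mult.commute)
qed

section \<open>Random choice of the output\<close>

lemma (in prob_space) integral_pair_point_measure:
  fixes h :: "'a \<times> 'i \<Rightarrow> real"
  assumes S: "finite S" and p: "\<And>i. i \<in> S \<Longrightarrow> 0 \<le> p i"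
    and h: "\<And>i. i \<in> S \<Longrightarrow> integrable M (\<lambda>\<omega>. h (\<omega>, i))"
  shows "integrable (M \<Otimes>\<^sub>M point_measure S (\<lambda>i. ennreal (p i))) h"
    and "(\<integral>z. h z \<partial>(M \<Otimes>\<^sub>M point_measure S (\<lambda>i. ennreal (p i)))) = (\<Sum>i\<in>S. p i * (\<integral>\<omega>. h (\<omega>, i) \<partial>M))"
proof -
  let ?N = "point_measure S (\<lambda>i. ennreal (p i))"
  have fin: "finite_measure ?N"
    by (rule finite_measureI) (simp add: space_point_measure emeasure_point_measure_finite S)
  interpret N: finite_measure ?N by fact
  interpret pair_sigma_finite M ?N ..
  have hm: "h \<in> borel_measurable (M \<Otimes>\<^sub>M ?N)"
  proof -
    \<comment> \<open>The index set is finite, so joint measurability follows from measurability of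
      each section; the library rule has the countable factor first, hence the swap.\<close>
    have "(\<lambda>(i, \<omega>). h (\<omega>, i)) \<in> borel_measurable (count_space S \<Otimes>\<^sub>M M)"
      using S h by (intro measurable_pair_measure_countable1) (auto intro: countable_finite)
    then have "(\<lambda>(i, \<omega>). h (\<omega>, i)) \<in> borel_measurable (?N \<Otimes>\<^sub>M M)"
      by (subst measurable_cong_sets[OF sets_pair_measure_cong refl])
        (auto simp: sets_point_measure)
    from measurable_pair_swap[OF this] show ?thesis by (simp add: case_prod_beta)
  qed
  show int: "integrable (M \<Otimes>\<^sub>M ?N) h"
  proof (rule Fubini_integrable[OF hm])
    show "integrable M (\<lambda>\<omega>. \<integral>i. norm (h (\<omega>, i)) \<partial>?N)"
      using S p h by (auto simp: lebesgue_integral_point_measure_finite)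
    show "AE \<omega> in M. integrable ?N (\<lambda>i. h (\<omega>, i))"
      using S by (simp add: integrable_point_measure_finite)
  qed
  have "(\<integral>z. h z \<partial>(M \<Otimes>\<^sub>M ?N)) = (\<integral>\<omega>. (\<integral>i. h (\<omega>, i) \<partial>?N) \<partial>M)"
    using integral_fst'[OF int] by simp
  also have "\<dots> = (\<integral>\<omega>. (\<Sum>i\<in>S. p i * h (\<omega>, i)) \<partial>M)"
    using S p by (simp add: lebesgue_integral_point_measure_finite)
  also have "\<dots> = (\<Sum>i\<in>S. p i * (\<integral>\<omega>. h (\<omega>, i) \<partial>M))"
    using h by (subst Bochner_Integration.integral_sum) auto
  finally show "(\<integral>z. h z \<partial>(M \<Otimes>\<^sub>M ?N)) = (\<Sum>i\<in>S. p i * (\<integral>\<omega>. h (\<omega>, i) \<partial>M))" .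
qed

text \<open>Makes uniform output the case of constant weights, which corresponds to
  \<open>\<rho> = 1\<close> in the recursions.\<close>

lemma uniform_index_weighted: "uniform_index T K = weighted_index T K (\<lambda>_. 1)"
  unfolding uniform_index_def weighted_index_def uniform_count_measure_def
  by (rule arg_cong[where f = "point_measure _"]) (auto simp: fun_eq_iff)

section \<open>Local SGD\<close>

lemma norm_diff_scaleR_square:
  fixes x y :: "'a::real_inner"
  shows "(norm (x - c *\<^sub>R y))\<^sup>2 = (norm x)\<^sup>2 - 2 * c * (x \<bullet> y) + c\<^sup>2 * (norm y)\<^sup>2"
  using dot_norm_neg[of x "c *\<^sub>R y"] by (simp add: power_mult_distrib)

lemma local_sgd_stepsize_0:
  assumes "K \<ge> 1"
  shows "local_sgd G x0 0 \<tau> K e t k = x0"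
  using assms by (induction t arbitrary: k) (simp_all add: Let_def sum_constant_scaleR)

text \<open>The measure is called \<open>P\<close> because \<open>M\<close> is the noise constant.
  The cap is a product, the form in which it is later combined with other bounds, and
  \<open>\<gamma> = 0\<close> is allowed because rule B can produce it.\<close>

locale sgd_run = prob_space P for P :: "'w measure" +
  fixes f :: "'a::euclidean_space \<Rightarrow> real" and G :: "'a \<Rightarrow> 'a" and x0 :: 'a
    and L M \<sigma> fstar \<gamma> :: real and K \<tau> :: nat and \<xi> :: "nat \<Rightarrow> nat \<Rightarrow> 'w \<Rightarrow> 'a"
  assumes L: "L > 0" and smooth: "L_smooth f G L" and fstar: "\<And>y. fstar \<le> f y"
    and K: "K \<ge> 1" and \<tau>: "\<tau> \<ge> 1" and M: "M \<ge> 0"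
    and \<gamma>: "\<gamma> \<ge> 0" "10 * (L * \<gamma> * (\<tau> * K + M)) \<le> 1"
    and noise: "bounded_noise P G M \<sigma> K (\<lambda>t k \<omega>. local_sgd G x0 \<gamma> \<tau> K (\<lambda>s j. \<xi> s j \<omega>) t k) \<xi>"
begin

definition x :: "nat \<Rightarrow> nat \<Rightarrow> 'w \<Rightarrow> 'a" where
  "x t k \<omega> = local_sgd G x0 \<gamma> \<tau> K (\<lambda>s j. \<xi> s j \<omega>) t k"

definition m :: "nat \<Rightarrow> 'w \<Rightarrow> 'a" where
  "m t \<omega> = avg K (\<lambda>k. x t k \<omega>)"

definition h :: "nat \<Rightarrow> 'w \<Rightarrow> 'a" where
  "h t \<omega> = avg K (\<lambda>k. G (x t k \<omega>))"

definition \<xi>m :: "nat \<Rightarrow> 'w \<Rightarrow> 'a" where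
  "\<xi>m t \<omega> = avg K (\<lambda>k. \<xi> t k \<omega>)"

definition query :: "nat \<Rightarrow> 'w measure" where
  "query t = generated_algebra P {x t j |j. j \<in> {1..K}}"

lemma lipschitz: "norm (G y - G z) \<le> L * norm (y - z)"
  using smooth by (simp add: L_smooth_def)

lemma continuous_G: "continuous_on UNIV G"
  using smooth L by (rule smooth_gradient_continuous)

lemma measurable_G [measurable]: "G \<in> borel_measurable borel"
  using continuous_G by (rule borel_measurable_continuous_onI)

lemma measurable_f [measurable]: "f \<in> borel_measurable borel"
  using smooth_continuous[OF smooth] by (rule borel_measurable_continuous_onI)

lemma x_0: "x 0 k \<omega> = x0"
  by (simp add: x_def)

lemma x_Suc: "x (Suc t) k \<omega> =
    (if \<tau> dvd Suc t then avg K (\<lambda>j. x t j \<omega> - \<gamma> *\<^sub>R (G (x t j \<omega>) + \<xi> t j \<omega>))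
     else x t k \<omega> - \<gamma> *\<^sub>R (G (x t k \<omega>) + \<xi> t k \<omega>))"
  by (simp add: x_def avg_def Let_def)

lemma m_0: "m 0 \<omega> = x0"
  using K by (simp add: m_def x_0)

lemma m_Suc: "m (Suc t) \<omega> = m t \<omega> - \<gamma> *\<^sub>R (h t \<omega> + \<xi>m t \<omega>)"
proof -
  have "m (Suc t) \<omega> = avg K (\<lambda>j. x t j \<omega> - \<gamma> *\<^sub>R (G (x t j \<omega>) + \<xi> t j \<omega>))"
    using K by (cases "\<tau> dvd Suc t") (simp_all add: m_def x_Suc)
  also have "\<dots> = m t \<omega> - \<gamma> *\<^sub>R (h t \<omega> + \<xi>m t \<omega>)"
    by (simp only: avg_diff avg_scaleR avg_add m_def h_def \<xi>m_def)
  finally show ?thesis .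
qed

text \<open>Grouped into a part that is determined by the query points and the centred noise, so
  that the mixed terms of the square have mean zero.\<close>

lemma x_Suc_minus_m: "x (Suc t) k \<omega> - m (Suc t) \<omega> =
    (if \<tau> dvd Suc t then 0
     else (x t k \<omega> - m t \<omega> - \<gamma> *\<^sub>R (G (x t k \<omega>) - h t \<omega>)) - \<gamma> *\<^sub>R (\<xi> t k \<omega> - \<xi>m t \<omega>))"
proof (cases "\<tau> dvd Suc t")
  case True
  then have "m (Suc t) \<omega> = avg K (\<lambda>_. x (Suc t) k \<omega>)"
    unfolding m_def by (simp only: x_Suc if_True)
  then show ?thesis using True K by simp
next
  case False
  then show ?thesis by (simp add: m_Suc x_Suc algebra_simps)
qed

section \<open>Measurability and square-integrability of the run\<close>

lemma measurable_\<xi>: "k \<in> {1..K} \<Longrightarrow> \<xi> t k \<in> borel_measurable P"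
  using noise by (simp add: bounded_noise_def)

lemma measurable_x: "k \<in> {1..K} \<Longrightarrow> x t k \<in> borel_measurable P"
proof (induction t arbitrary: k)
  case 0
  have "x 0 k = (\<lambda>_. x0)" by (simp add: x_0 fun_eq_iff)
  then show ?case by simp
next
  case (Suc t)
  have y: "(\<lambda>\<omega>. x t j \<omega> - \<gamma> *\<^sub>R (G (x t j \<omega>) + \<xi> t j \<omega>)) \<in> borel_measurable P"
    if "j \<in> {1..K}" for j
    using Suc.IH[OF that] measurable_\<xi>[OF that] by measurable
  have "(\<lambda>\<omega>. x (Suc t) k \<omega>) \<in> borel_measurable P"
  proof (cases "\<tau> dvd Suc t")
    case True
    have "(\<lambda>\<omega>. \<Sum>j=1..K. x t j \<omega> - \<gamma> *\<^sub>R (G (x t j \<omega>) + \<xi> t j \<omega>)) \<in> borel_measurable P"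
      using y by (rule borel_measurable_sum)
    then show ?thesis using True by (simp add: x_Suc avg_def)
  next
    case False
    then show ?thesis using y[OF Suc.prems] by (simp add: x_Suc)
  qed
  then show ?case by simp
qed

lemma query_subalgebra: "subalgebra P (query t)"
  unfolding query_def by (rule subalgebra_generated) (auto intro: measurable_x)

lemma measurable_x_query: "k \<in> {1..K} \<Longrightarrow> x t k \<in> borel_measurable (query t)"
  unfolding query_def by (rule measurable_generated) auto

lemma noise_mean:
  assumes "k \<in> {1..K}" "b \<in> Basis"
  shows "AE \<omega> in P. real_cond_exp P (query t) (\<lambda>\<omega>. \<xi> t k \<omega> \<bullet> b) \<omega> = 0"
  using noise assms by (simp add: bounded_noise_def Let_def query_def x_def[abs_def])

lemma noise_second_moment:
  assumes "k \<in> {1..K}"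
  shows "AE \<omega> in P. nn_cond_exp P (query t) (\<lambda>\<omega>. ennreal ((norm (\<xi> t k \<omega>))\<^sup>2)) \<omega>
    \<le> ennreal (M * (norm (G (x t k \<omega>)))\<^sup>2 + \<sigma>\<^sup>2)"
  using noise assms by (simp add: bounded_noise_def Let_def query_def x_def[abs_def])

lemma noise_indep:
  assumes "k \<in> {1..K}"
  shows "cond_indep P (query t) (generated_algebra P {\<xi> t k})
    (generated_algebra P ({x s j |s j. s \<le> t \<and> j \<in> {1..K}} \<union> {\<xi> s j |s j. s < t \<and> j \<in> {1..K}}
      \<union> {\<xi> t j |j. j \<in> {1..K} \<and> j \<noteq> k}))"
  using noise assms by (simp add: bounded_noise_def Let_def query_def x_def[abs_def])

text \<open>The second moment is first bounded as an extended nonnegative integral, where the tower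
  property is available without integrability. The bound is finite because the gradient at a
  square-integrable point is square-integrable, and only then are real expectations formed.\<close>

lemma sq_int_noise_step:
  assumes k: "k \<in> {1..K}" and x: "sq_int P (x t k)"
  shows "sq_int P (\<xi> t k)"
    and "expectation (\<lambda>\<omega>. (norm (\<xi> t k \<omega>))\<^sup>2) \<le> M * expectation (\<lambda>\<omega>. (norm (G (x t k \<omega>)))\<^sup>2) + \<sigma>\<^sup>2"
proof -
  interpret Q: sigma_finite_subalgebra P "query t"
    using query_subalgebra by (rule subalgebra_sigma_finite)
  have [measurable]: "\<xi> t k \<in> borel_measurable P" using k by (rule measurable_\<xi>)
  have iG: "integrable P (\<lambda>\<omega>. (norm (G (x t k \<omega>)))\<^sup>2)"
    using sq_int_lipschitz[OF x continuous_G lipschitz] by (rule sq_int_integrable)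
  have "(\<integral>\<^sup>+\<omega>. ennreal ((norm (\<xi> t k \<omega>))\<^sup>2) \<partial>P)
      = (\<integral>\<^sup>+\<omega>. nn_cond_exp P (query t) (\<lambda>\<omega>. ennreal ((norm (\<xi> t k \<omega>))\<^sup>2)) \<omega> \<partial>P)"
    using Q.nn_cond_exp_intg[of "\<lambda>_. 1" "\<lambda>\<omega>. ennreal ((norm (\<xi> t k \<omega>))\<^sup>2)"] by simp
  also have "\<dots> \<le> (\<integral>\<^sup>+\<omega>. ennreal (M * (norm (G (x t k \<omega>)))\<^sup>2 + \<sigma>\<^sup>2) \<partial>P)"
    using noise_second_moment[OF k] by (rule nn_integral_mono_AE)
  also have "\<dots> = ennreal (\<integral>\<omega>. M * (norm (G (x t k \<omega>)))\<^sup>2 + \<sigma>\<^sup>2 \<partial>P)"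
    using iG M by (intro nn_integral_eq_integral) auto
  also have "(\<integral>\<omega>. M * (norm (G (x t k \<omega>)))\<^sup>2 + \<sigma>\<^sup>2 \<partial>P)
      = M * expectation (\<lambda>\<omega>. (norm (G (x t k \<omega>)))\<^sup>2) + \<sigma>\<^sup>2"
    using iG by (simp add: prob_space)
  finally have le: "(\<integral>\<^sup>+\<omega>. ennreal ((norm (\<xi> t k \<omega>))\<^sup>2) \<partial>P)
      \<le> ennreal (M * expectation (\<lambda>\<omega>. (norm (G (x t k \<omega>)))\<^sup>2) + \<sigma>\<^sup>2)" .
  have i\<xi>: "integrable P (\<lambda>\<omega>. (norm (\<xi> t k \<omega>))\<^sup>2)"
    using le_less_trans[OF le ennreal_less_top] by (intro integrableI_bounded) auto
  then show "sq_int P (\<xi> t k)" by (simp add: sq_int_def)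
  have "0 \<le> M * expectation (\<lambda>\<omega>. (norm (G (x t k \<omega>)))\<^sup>2) + \<sigma>\<^sup>2"
    using M by (simp add: Bochner_Integration.integral_nonneg)
  then show "expectation (\<lambda>\<omega>. (norm (\<xi> t k \<omega>))\<^sup>2)
      \<le> M * expectation (\<lambda>\<omega>. (norm (G (x t k \<omega>)))\<^sup>2) + \<sigma>\<^sup>2"
    using le nn_integral_eq_integral[OF i\<xi>] by (simp add: ennreal_le_iff)
qed

text \<open>The induction alternates: square-integrable iterates give square-integrable noise in the
  same step, and both together give the next iterates.\<close>

lemma sq_int_x: "k \<in> {1..K} \<Longrightarrow> sq_int P (x t k)"
proof (induction t arbitrary: k)
  case 0
  have "x 0 k = (\<lambda>_. x0)" by (simp add: x_0 fun_eq_iff)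
  then show ?case by (simp add: sq_int_const)
next
  case (Suc t)
  have y: "sq_int P (\<lambda>\<omega>. x t j \<omega> - \<gamma> *\<^sub>R (G (x t j \<omega>) + \<xi> t j \<omega>))" if "j \<in> {1..K}" for j
    using Suc.IH[OF that] sq_int_noise_step(1)[OF that Suc.IH[OF that]]
    by (intro sq_int_diff sq_int_scaleR sq_int_add sq_int_lipschitz[OF _ continuous_G lipschitz])
  have "sq_int P (\<lambda>\<omega>. x (Suc t) k \<omega>)"
  proof (cases "\<tau> dvd Suc t")
    case True
    then show ?thesis using sq_int_avg[OF y] by (simp add: x_Suc)
  next
    case False
    then show ?thesis using y[OF Suc.prems] by (simp add: x_Suc)
  qed
  then show ?case by simp
qed

lemma sq_int_\<xi>: "k \<in> {1..K} \<Longrightarrow> sq_int P (\<xi> t k)"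
  using sq_int_noise_step(1) sq_int_x by blast

lemma sq_int_G: "k \<in> {1..K} \<Longrightarrow> sq_int P (\<lambda>\<omega>. G (x t k \<omega>))"
  using sq_int_lipschitz[OF sq_int_x continuous_G lipschitz] .

lemma sq_int_m: "sq_int P (m t)"
  using sq_int_avg[OF sq_int_x] by (simp add: m_def[abs_def])

lemma sq_int_h: "sq_int P (h t)"
  using sq_int_avg[OF sq_int_G] by (simp add: h_def[abs_def])

lemma sq_int_\<xi>m: "sq_int P (\<xi>m t)"
  using sq_int_avg[OF sq_int_\<xi>] by (simp add: \<xi>m_def[abs_def])

section \<open>Orthogonality of the noise\<close>

lemma measurable_G_query: "k \<in> {1..K} \<Longrightarrow> (\<lambda>\<omega>. G (x t k \<omega>)) \<in> borel_measurable (query t)"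
  using measurable_compose[OF measurable_x_query measurable_G] .

lemma measurable_m_query: "m t \<in> borel_measurable (query t)"
proof -
  have "(\<lambda>\<omega>. \<Sum>j=1..K. x t j \<omega>) \<in> borel_measurable (query t)"
    by (intro borel_measurable_sum measurable_x_query)
  then show ?thesis unfolding m_def[abs_def] avg_def by measurable
qed

lemma measurable_h_query: "h t \<in> borel_measurable (query t)"
proof -
  have "(\<lambda>\<omega>. \<Sum>j=1..K. G (x t j \<omega>)) \<in> borel_measurable (query t)"
    by (intro borel_measurable_sum measurable_G_query)
  then show ?thesis unfolding h_def[abs_def] avg_def by measurable
qed

text \<open>The inner product is expanded in the basis because the conditional mean of the noise is
  prescribed coordinate by coordinate.\<close>

lemma noise_orthogonal_query:
  assumes k: "k \<in> {1..K}" and Y: "sq_int P Y" "Y \<in> borel_measurable (query t)"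
  shows "expectation (\<lambda>\<omega>. Y \<omega> \<bullet> \<xi> t k \<omega>) = 0"
proof -
  interpret Q: sigma_finite_subalgebra P "query t"
    using query_subalgebra by (rule subalgebra_sigma_finite)
  have i: "integrable P (\<lambda>\<omega>. (Y \<omega> \<bullet> b) * (\<xi> t k \<omega> \<bullet> b))" if "b \<in> Basis" for b
    using sq_int_inner[OF sq_int_component[OF Y(1) that] sq_int_component[OF sq_int_\<xi>[OF k] that]]
    by simp
  have "expectation (\<lambda>\<omega>. Y \<omega> \<bullet> \<xi> t k \<omega>) = expectation (\<lambda>\<omega>. \<Sum>b\<in>Basis. (Y \<omega> \<bullet> b) * (\<xi> t k \<omega> \<bullet> b))"
    by (subst euclidean_inner) simp
  also have "\<dots> = (\<Sum>b\<in>Basis. expectation (\<lambda>\<omega>. (Y \<omega> \<bullet> b) * (\<xi> t k \<omega> \<bullet> b)))"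
    using i by (rule Bochner_Integration.integral_sum)
  also have "\<dots> = 0"
    using i Y(2) measurable_\<xi>[OF k] noise_mean[OF k]
    by (intro sum.neutral ballI Q.integral_mult_eq_0) auto
  finally show ?thesis .
qed

text \<open>The noise of worker \<open>j\<close> generates part of the algebra from which that of
  worker \<open>k\<close> is conditionally independent, so each coordinate product integrates to
  zero. This is the source of the factor \<open>1 / K\<close>.\<close>

lemma noise_orthogonal_workers:
  assumes k: "k \<in> {1..K}" and j: "j \<in> {1..K}" and "j \<noteq> k"
  shows "expectation (\<lambda>\<omega>. \<xi> t k \<omega> \<bullet> \<xi> t j \<omega>) = 0"
proof -
  let ?others = "{x s j |s j. s \<le> t \<and> j \<in> {1..K}} \<union> {\<xi> s j |s j. s < t \<and> j \<in> {1..K}}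
      \<union> {\<xi> t j |j. j \<in> {1..K} \<and> j \<noteq> k}"
  have A: "subalgebra P (generated_algebra P {\<xi> t k})"
    using k by (intro subalgebra_generated) (auto intro: measurable_\<xi>)
  have B: "subalgebra P (generated_algebra P ?others)"
    by (rule subalgebra_generated) (auto intro: measurable_\<xi> measurable_x)
  have i: "integrable P (\<lambda>\<omega>. (\<xi> t k \<omega> \<bullet> b) * (\<xi> t j \<omega> \<bullet> b))" if "b \<in> Basis" for b
    using sq_int_inner[OF sq_int_component[OF sq_int_\<xi>[OF k] that] sq_int_component[OF sq_int_\<xi>[OF j] that]]
    by simp
  have k': "\<xi> t k \<in> borel_measurable (generated_algebra P {\<xi> t k})"
    by (rule measurable_generated) simp
  have j': "\<xi> t j \<in> borel_measurable (generated_algebra P ?others)"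
    using j \<open>j \<noteq> k\<close> by (intro measurable_generated) auto
  have "expectation (\<lambda>\<omega>. \<xi> t k \<omega> \<bullet> \<xi> t j \<omega>)
      = expectation (\<lambda>\<omega>. \<Sum>b\<in>Basis. (\<xi> t k \<omega> \<bullet> b) * (\<xi> t j \<omega> \<bullet> b))"
    by (subst euclidean_inner) simp
  also have "\<dots> = (\<Sum>b\<in>Basis. expectation (\<lambda>\<omega>. (\<xi> t k \<omega> \<bullet> b) * (\<xi> t j \<omega> \<bullet> b)))"
    using i by (rule Bochner_Integration.integral_sum)
  also have "\<dots> = 0"
    using i k' j' sq_int_real_integrable[OF sq_int_component[OF sq_int_\<xi>[OF k]]]
    by (intro sum.neutral ballI
        integral_mult_cond_indep_eq_0[OF query_subalgebra A B noise_indep[OF k]] noise_mean[OF k]) auto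
  finally show ?thesis .
qed

section \<open>Mean squared gradient, mean squared deviation and mean suboptimality\<close>

definition A :: "nat \<Rightarrow> real" where
  "A t = avg K (\<lambda>k. expectation (\<lambda>\<omega>. (norm (G (x t k \<omega>)))\<^sup>2))"

definition R :: "nat \<Rightarrow> real" where
  "R t = avg K (\<lambda>k. expectation (\<lambda>\<omega>. (norm (x t k \<omega> - m t \<omega>))\<^sup>2))"

definition F :: "nat \<Rightarrow> real" where
  "F t = avg K (\<lambda>k. expectation (\<lambda>\<omega>. f (x t k \<omega>) - fstar))"

lemma integrable_G: "k \<in> {1..K} \<Longrightarrow> integrable P (\<lambda>\<omega>. (norm (G (x t k \<omega>)))\<^sup>2)"
  using sq_int_G by (rule sq_int_integrable)

lemma integrable_dev: "k \<in> {1..K} \<Longrightarrow> integrable P (\<lambda>\<omega>. (norm (x t k \<omega> - m t \<omega>))\<^sup>2)"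
  using sq_int_diff[OF sq_int_x sq_int_m] by (rule sq_int_integrable)

lemma integrable_f:
  assumes "sq_int P X"
  shows "integrable P (\<lambda>\<omega>. f (X \<omega>))"
proof -
  have [measurable]: "X \<in> borel_measurable P" using assms by (rule sq_int_measurable)
  have "integrable P (\<lambda>\<omega>. f (X \<omega>) - fstar)"
  proof (rule Bochner_Integration.integrable_bound)
    show "integrable P (\<lambda>\<omega>. 2 * (f 0 - fstar) + L * (norm (X \<omega>))\<^sup>2)"
      using assms by (simp add: sq_int_def)
    show "AE \<omega> in P. norm (f (X \<omega>) - fstar) \<le> norm (2 * (f 0 - fstar) + L * (norm (X \<omega>))\<^sup>2)"
      using smooth_upper_bound[OF smooth L fstar] fstar by (intro AE_I2) (smt (verit) real_norm_def)
  qed measurable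
  from Bochner_Integration.integrable_add[OF this integrable_const[of fstar]] show ?thesis by simp
qed

lemma integrable_F: "k \<in> {1..K} \<Longrightarrow> integrable P (\<lambda>\<omega>. f (x t k \<omega>) - fstar)"
  using integrable_f[OF sq_int_x] by simp

lemma A_nonneg: "A t \<ge> 0"
  unfolding A_def by (intro avg_nonneg Bochner_Integration.integral_nonneg) simp

lemma R_nonneg: "R t \<ge> 0"
  unfolding R_def by (intro avg_nonneg Bochner_Integration.integral_nonneg) simp

lemma F_nonneg: "F t \<ge> 0"
  unfolding F_def using fstar by (intro avg_nonneg Bochner_Integration.integral_nonneg) simp

lemma R_0: "R 0 = 0"
  using K by (simp add: R_def x_0 m_0)

lemma A_le_F: "A t \<le> 2 * L * F t"
proof -
  have "A t \<le> avg K (\<lambda>k. 2 * L * expectation (\<lambda>\<omega>. f (x t k \<omega>) - fstar))"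
    unfolding A_def
  proof (rule avg_mono)
    fix k assume k: "k \<in> {1..K}"
    have "expectation (\<lambda>\<omega>. (norm (G (x t k \<omega>)))\<^sup>2)
        \<le> expectation (\<lambda>\<omega>. 2 * L * (f (x t k \<omega>) - fstar))"
      by (rule integral_mono[OF integrable_G[OF k] integrable_mult_right[OF integrable_F[OF k]]])
        (rule smooth_norm_gradient_le[OF smooth L fstar])
    then show "expectation (\<lambda>\<omega>. (norm (G (x t k \<omega>)))\<^sup>2)
        \<le> 2 * L * expectation (\<lambda>\<omega>. f (x t k \<omega>) - fstar)" by simp
  qed
  then show ?thesis unfolding F_def avg_mult .
qed

lemma noise_le: "avg K (\<lambda>k. expectation (\<lambda>\<omega>. (norm (\<xi> t k \<omega>))\<^sup>2)) \<le> M * A t + \<sigma>\<^sup>2"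
proof -
  have "avg K (\<lambda>k. expectation (\<lambda>\<omega>. (norm (\<xi> t k \<omega>))\<^sup>2))
      \<le> avg K (\<lambda>k. M * expectation (\<lambda>\<omega>. (norm (G (x t k \<omega>)))\<^sup>2) + \<sigma>\<^sup>2)"
    by (intro avg_mono sq_int_noise_step(2) sq_int_x)
  also have "\<dots> = M * A t + \<sigma>\<^sup>2" using K by (simp add: avg_add avg_mult A_def)
  finally show ?thesis .
qed

text \<open>The squared norm of the average is a double average of inner products. Only the diagonal
  survives, one term out of \<open>K\<close> in each inner average.\<close>

lemma noise_mean_le: "expectation (\<lambda>\<omega>. (norm (\<xi>m t \<omega>))\<^sup>2) \<le> (M * A t + \<sigma>\<^sup>2) / K"
proof -
  have "expectation (\<lambda>\<omega>. (norm (\<xi>m t \<omega>))\<^sup>2) = expectation (\<lambda>\<omega>. avg K (\<lambda>k. avg K (\<lambda>j. \<xi> t k \<omega> \<bullet> \<xi> t j \<omega>)))"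
    by (simp only: power2_norm_eq_inner \<xi>m_def inner_avg_left) (simp only: inner_avg_right)
  also have "\<dots> = avg K (\<lambda>k. avg K (\<lambda>j. expectation (\<lambda>\<omega>. \<xi> t k \<omega> \<bullet> \<xi> t j \<omega>)))"
  proof (subst integrable_avg(2))
    show "integrable P (\<lambda>\<omega>. avg K (\<lambda>j. \<xi> t k \<omega> \<bullet> \<xi> t j \<omega>))" if "k \<in> {1..K}" for k
      using that by (intro integrable_avg(1) sq_int_inner sq_int_\<xi>)
    show "avg K (\<lambda>k. expectation (\<lambda>\<omega>. avg K (\<lambda>j. \<xi> t k \<omega> \<bullet> \<xi> t j \<omega>)))
      = avg K (\<lambda>k. avg K (\<lambda>j. expectation (\<lambda>\<omega>. \<xi> t k \<omega> \<bullet> \<xi> t j \<omega>)))"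
      by (rule avg_cong, rule integrable_avg(2)) (rule sq_int_inner[OF sq_int_\<xi> sq_int_\<xi>])
  qed
  also have "\<dots> = avg K (\<lambda>k. expectation (\<lambda>\<omega>. (norm (\<xi> t k \<omega>))\<^sup>2) / K)"
  proof (rule avg_cong)
    fix k assume k: "k \<in> {1..K}"
    have "(\<Sum>j=1..K. expectation (\<lambda>\<omega>. \<xi> t k \<omega> \<bullet> \<xi> t j \<omega>)) = expectation (\<lambda>\<omega>. \<xi> t k \<omega> \<bullet> \<xi> t k \<omega>)"
      using k noise_orthogonal_workers[OF k] by (simp add: sum.remove[of _ k])
    then show "avg K (\<lambda>j. expectation (\<lambda>\<omega>. \<xi> t k \<omega> \<bullet> \<xi> t j \<omega>)) = expectation (\<lambda>\<omega>. (norm (\<xi> t k \<omega>))\<^sup>2) / K"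
      by (simp add: avg_def power2_norm_eq_inner)
  qed
  also have "\<dots> = avg K (\<lambda>k. expectation (\<lambda>\<omega>. (norm (\<xi> t k \<omega>))\<^sup>2)) / K"
    by (simp add: avg_def sum_divide_distrib)
  also have "\<dots> \<le> (M * A t + \<sigma>\<^sup>2) / K"
    using noise_le by (intro divide_right_mono) auto
  finally show ?thesis .
qed

lemma noise_mean_orthogonal:
  assumes Y: "sq_int P Y" "Y \<in> borel_measurable (query t)"
  shows "expectation (\<lambda>\<omega>. Y \<omega> \<bullet> \<xi>m t \<omega>) = 0"
proof -
  have "expectation (\<lambda>\<omega>. Y \<omega> \<bullet> \<xi>m t \<omega>) = avg K (\<lambda>k. expectation (\<lambda>\<omega>. Y \<omega> \<bullet> \<xi> t k \<omega>))"
    unfolding \<xi>m_def inner_avg_right using sq_int_inner[OF Y(1) sq_int_\<xi>] by (rule integrable_avg)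
  also have "\<dots> = avg K (\<lambda>k. 0)"
    using noise_orthogonal_query[OF _ Y] by (intro avg_cong)
  finally show ?thesis by (simp add: avg_def)
qed

text \<open>Young's inequality with \<open>\<theta> = 1 / (2 * \<tau>)\<close> separates the old
  deviation from the gradient step, and the noise enters only through its second moment. That moment
  carries no factor \<open>1 / K\<close>, as it belongs to single workers.\<close>

lemma R_Suc_le:
  "R (Suc t) \<le> (if \<tau> dvd Suc t then 0
     else (1 + 1 / (2 * real \<tau>)) * R t + \<gamma>\<^sup>2 * ((1 + 2 * \<tau> + M) * A t + \<sigma>\<^sup>2))"
proof (cases "\<tau> dvd Suc t")
  case True
  then show ?thesis by (simp add: R_def x_Suc_minus_m avg_def)
next
  case False
  let ?\<theta> = "1 / (2 * real \<tau>)"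
  define u where "u k \<omega> = x t k \<omega> - m t \<omega> - \<gamma> *\<^sub>R (G (x t k \<omega>) - h t \<omega>)" for k \<omega>
  have su: "sq_int P (u k)" if "k \<in> {1..K}" for k
    unfolding u_def using that
    by (intro sq_int_diff sq_int_scaleR sq_int_x sq_int_m sq_int_G sq_int_h)
  have mu: "u k \<in> borel_measurable (query t)" if "k \<in> {1..K}" for k
    unfolding u_def
    using measurable_x_query[OF that] measurable_G_query[OF that] measurable_m_query measurable_h_query
    by measurable
  \<comment> \<open>Since the \<open>u k\<close> average to zero, subtracting the common vector
    \<open>\<xi>m\<close> from every noise leaves no mixed term.\<close>
  have u0: "avg K (\<lambda>k. u k \<omega>) = 0" for \<omega>
    using K by (simp add: u_def avg_diff avg_scaleR m_def h_def)
  have pointwise: "avg K (\<lambda>k. (norm (x (Suc t) k \<omega> - m (Suc t) \<omega>))\<^sup>2)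
      \<le> (1 + ?\<theta>) * avg K (\<lambda>k. (norm (x t k \<omega> - m t \<omega>))\<^sup>2)
        + (1 + 2 * \<tau>) * \<gamma>\<^sup>2 * avg K (\<lambda>k. (norm (G (x t k \<omega>)))\<^sup>2)
        - 2 * \<gamma> * avg K (\<lambda>k. u k \<omega> \<bullet> \<xi> t k \<omega>) + \<gamma>\<^sup>2 * avg K (\<lambda>k. (norm (\<xi> t k \<omega>))\<^sup>2)" for \<omega>
  proof -
    have "avg K (\<lambda>k. (norm (x (Suc t) k \<omega> - m (Suc t) \<omega>))\<^sup>2)
      = avg K (\<lambda>k. (norm (u k \<omega>))\<^sup>2 - 2 * \<gamma> * (u k \<omega> \<bullet> \<xi> t k \<omega> - u k \<omega> \<bullet> \<xi>m t \<omega>)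
          + \<gamma>\<^sup>2 * (norm (\<xi> t k \<omega> - \<xi>m t \<omega>))\<^sup>2)"
    proof (rule avg_cong)
      fix k
      have "x (Suc t) k \<omega> - m (Suc t) \<omega> = u k \<omega> - \<gamma> *\<^sub>R (\<xi> t k \<omega> - \<xi>m t \<omega>)"
        using False by (simp only: x_Suc_minus_m u_def if_False)
      then show "(norm (x (Suc t) k \<omega> - m (Suc t) \<omega>))\<^sup>2
        = (norm (u k \<omega>))\<^sup>2 - 2 * \<gamma> * (u k \<omega> \<bullet> \<xi> t k \<omega> - u k \<omega> \<bullet> \<xi>m t \<omega>)
          + \<gamma>\<^sup>2 * (norm (\<xi> t k \<omega> - \<xi>m t \<omega>))\<^sup>2"
        by (simp only: norm_diff_scaleR_square inner_diff_right)
    qed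
    also have "\<dots> = avg K (\<lambda>k. (norm (u k \<omega>))\<^sup>2)
        - 2 * \<gamma> * (avg K (\<lambda>k. u k \<omega> \<bullet> \<xi> t k \<omega>) - avg K (\<lambda>k. u k \<omega> \<bullet> \<xi>m t \<omega>))
        + \<gamma>\<^sup>2 * avg K (\<lambda>k. (norm (\<xi> t k \<omega> - \<xi>m t \<omega>))\<^sup>2)"
      by (simp only: avg_add avg_diff avg_mult)
    also have "avg K (\<lambda>k. u k \<omega> \<bullet> \<xi>m t \<omega>) = 0"
      using u0[of \<omega>] by (simp add: inner_avg_left[symmetric])
    also have "avg K (\<lambda>k. (norm (\<xi> t k \<omega> - \<xi>m t \<omega>))\<^sup>2) \<le> avg K (\<lambda>k. (norm (\<xi> t k \<omega>))\<^sup>2)"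
      unfolding \<xi>m_def by (rule avg_norm_deviation_le[OF K])
    finally have 1: "avg K (\<lambda>k. (norm (x (Suc t) k \<omega> - m (Suc t) \<omega>))\<^sup>2)
      \<le> avg K (\<lambda>k. (norm (u k \<omega>))\<^sup>2) - 2 * \<gamma> * avg K (\<lambda>k. u k \<omega> \<bullet> \<xi> t k \<omega>)
        + \<gamma>\<^sup>2 * avg K (\<lambda>k. (norm (\<xi> t k \<omega>))\<^sup>2)"
      by (simp add: mult_left_mono)
    \<comment> \<open>The factor \<open>1 + 2 * \<tau>\<close> is \<open>1 + 1 / \<theta>\<close>.
      The deviation \<open>G - h\<close> is then replaced by \<open>G\<close>, as centring does not
      increase the mean square.\<close>
    have "avg K (\<lambda>k. (norm (u k \<omega>))\<^sup>2) \<le> avg K (\<lambda>k. (1 + ?\<theta>) * (norm (x t k \<omega> - m t \<omega>))\<^sup>2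
        + (1 + 2 * \<tau>) * \<gamma>\<^sup>2 * (norm (G (x t k \<omega>) - h t \<omega>))\<^sup>2)"
    proof (rule avg_mono)
      fix k
      show "(norm (u k \<omega>))\<^sup>2 \<le> (1 + ?\<theta>) * (norm (x t k \<omega> - m t \<omega>))\<^sup>2
        + (1 + 2 * \<tau>) * \<gamma>\<^sup>2 * (norm (G (x t k \<omega>) - h t \<omega>))\<^sup>2"
        using norm_diff_scaled_le[of ?\<theta> "x t k \<omega> - m t \<omega>" "\<gamma> *\<^sub>R (G (x t k \<omega>) - h t \<omega>)"] \<tau>
        by (simp add: u_def power_mult_distrib mult.assoc)
    qed
    also have "\<dots> = (1 + ?\<theta>) * avg K (\<lambda>k. (norm (x t k \<omega> - m t \<omega>))\<^sup>2)
        + (1 + 2 * \<tau>) * \<gamma>\<^sup>2 * avg K (\<lambda>k. (norm (G (x t k \<omega>) - h t \<omega>))\<^sup>2)"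
      by (simp only: avg_add avg_mult)
    also have "\<dots> \<le> (1 + ?\<theta>) * avg K (\<lambda>k. (norm (x t k \<omega> - m t \<omega>))\<^sup>2)
        + (1 + 2 * \<tau>) * \<gamma>\<^sup>2 * avg K (\<lambda>k. (norm (G (x t k \<omega>)))\<^sup>2)"
      unfolding h_def by (intro add_left_mono mult_left_mono avg_norm_deviation_le[OF K]) auto
    finally show ?thesis using 1 by simp
  qed
  have i: "integrable P (\<lambda>\<omega>. avg K (\<lambda>k. (norm (x t k \<omega> - m t \<omega>))\<^sup>2))" for t
    by (intro integrable_avg integrable_dev)
  have iG: "integrable P (\<lambda>\<omega>. avg K (\<lambda>k. (norm (G (x t k \<omega>)))\<^sup>2))"
    by (intro integrable_avg integrable_G)
  have iu: "integrable P (\<lambda>\<omega>. avg K (\<lambda>k. u k \<omega> \<bullet> \<xi> t k \<omega>))"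
    by (intro integrable_avg sq_int_inner su sq_int_\<xi>)
  have i\<xi>: "integrable P (\<lambda>\<omega>. avg K (\<lambda>k. (norm (\<xi> t k \<omega>))\<^sup>2))"
    by (intro integrable_avg sq_int_integrable sq_int_\<xi>)
  have R: "R t = expectation (\<lambda>\<omega>. avg K (\<lambda>k. (norm (x t k \<omega> - m t \<omega>))\<^sup>2))" for t
    unfolding R_def by (rule integrable_avg(2)[symmetric]) (rule integrable_dev)
  have A: "A t = expectation (\<lambda>\<omega>. avg K (\<lambda>k. (norm (G (x t k \<omega>)))\<^sup>2))"
    unfolding A_def by (rule integrable_avg(2)[symmetric]) (rule integrable_G)
  have N: "expectation (\<lambda>\<omega>. avg K (\<lambda>k. (norm (\<xi> t k \<omega>))\<^sup>2)) \<le> M * A t + \<sigma>\<^sup>2"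
    using noise_le integrable_avg(2)[of K P "\<lambda>k \<omega>. (norm (\<xi> t k \<omega>))\<^sup>2"] sq_int_integrable[OF sq_int_\<xi>]
    by simp
  have U: "expectation (\<lambda>\<omega>. avg K (\<lambda>k. u k \<omega> \<bullet> \<xi> t k \<omega>)) = 0"
  proof -
    have "expectation (\<lambda>\<omega>. avg K (\<lambda>k. u k \<omega> \<bullet> \<xi> t k \<omega>)) = avg K (\<lambda>k. expectation (\<lambda>\<omega>. u k \<omega> \<bullet> \<xi> t k \<omega>))"
      by (intro integrable_avg sq_int_inner su sq_int_\<xi>)
    also have "\<dots> = avg K (\<lambda>k. 0)"
      by (intro avg_cong noise_orthogonal_query su mu)
    finally show ?thesis by (simp add: avg_def)
  qed
  have "R (Suc t) \<le> expectation (\<lambda>\<omega>. (1 + ?\<theta>) * avg K (\<lambda>k. (norm (x t k \<omega> - m t \<omega>))\<^sup>2)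
        + (1 + 2 * \<tau>) * \<gamma>\<^sup>2 * avg K (\<lambda>k. (norm (G (x t k \<omega>)))\<^sup>2)
        - 2 * \<gamma> * avg K (\<lambda>k. u k \<omega> \<bullet> \<xi> t k \<omega>) + \<gamma>\<^sup>2 * avg K (\<lambda>k. (norm (\<xi> t k \<omega>))\<^sup>2))"
    unfolding R by (rule integral_mono[OF i _ pointwise]) (use i iG iu i\<xi> in simp)
  also have "\<dots> = (1 + ?\<theta>) * R t + (1 + 2 * \<tau>) * \<gamma>\<^sup>2 * A t
      + \<gamma>\<^sup>2 * expectation (\<lambda>\<omega>. avg K (\<lambda>k. (norm (\<xi> t k \<omega>))\<^sup>2))"
    using i iG iu i\<xi> U by (simp add: R A)
  also have "\<dots> \<le> (1 + ?\<theta>) * R t + (1 + 2 * \<tau>) * \<gamma>\<^sup>2 * A t + \<gamma>\<^sup>2 * (M * A t + \<sigma>\<^sup>2)"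
    using N by (simp add: mult_left_mono)
  finally show ?thesis using False by (simp add: algebra_simps)
qed


text \<open>The three forms in which the cap is used: averaged noise, conversion of accumulated
  single-worker noise into noise of size \<open>1 / K\<close>, and gradient terms created by the
  deviation.\<close>

lemma stepsize_bounds:
  shows "L * \<gamma> * (1 + M / K) \<le> 1 / 10" "10 * (L * \<gamma> * \<tau>) \<le> 1 / K"
    "L * \<gamma> * (1 + 2 * \<tau> + M) \<le> 3 / 10"
proof -
  have K1: "1 \<le> real K" and \<tau>1: "1 \<le> real \<tau>" using K \<tau> by simp_all
  have \<tau>K: "real \<tau> \<le> \<tau> * K" using K1 \<tau>1 by simp
  have L\<gamma>: "0 \<le> L * \<gamma>" using L \<gamma> by simp
  \<comment> \<open>It suffices to compare each factor with a multiple \<open>n\<close> of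
    \<open>\<tau> * K + M\<close>; below, \<open>n\<close> is 1 or 3.\<close>
  have le: "L * \<gamma> * c \<le> n / 10" if "c \<le> n * (\<tau> * K + M)" "0 \<le> n" for c n
  proof -
    have "L * \<gamma> * c \<le> n * (L * \<gamma> * (\<tau> * K + M))"
      using mult_left_mono[OF that(1) L\<gamma>] by (simp add: mult_ac)
    also have "\<dots> \<le> n * (1 / 10)" using \<gamma>(2) that(2) by (intro mult_left_mono) auto
    finally show ?thesis by simp
  qed
  have "M / K \<le> M" using mult_left_mono[OF K1 M] K1 by (simp add: divide_le_eq)
  with order_trans[OF \<tau>1 \<tau>K] have "1 + M / K \<le> 1 * (\<tau> * K + M)"
    unfolding mult_1 by (rule add_mono)
  from le[OF this] show "L * \<gamma> * (1 + M / K) \<le> 1 / 10" by simp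
  have "1 + 2 * \<tau> + M \<le> 3 * (real \<tau> + M)" using \<tau>1 M by simp
  also have "\<dots> \<le> 3 * (\<tau> * K + M)" using \<tau>K by (intro mult_left_mono add_right_mono) simp_all
  finally have "1 + 2 * \<tau> + M \<le> 3 * (\<tau> * K + M)" .
  from le[OF this] show "L * \<gamma> * (1 + 2 * \<tau> + M) \<le> 3 / 10" by simp
  have "L * \<gamma> * (\<tau> * K) \<le> 1 / 10" using le[of "\<tau> * K" 1] M by simp
  then show "10 * (L * \<gamma> * \<tau>) \<le> 1 / K" using K1 by (simp add: field_simps)
qed

lemma integrable_avg_dev: "integrable P (\<lambda>\<omega>. avg K (\<lambda>k. (norm (x t k \<omega> - m t \<omega>))\<^sup>2))"
  by (intro integrable_avg integrable_dev)

lemma integrable_avg_G: "integrable P (\<lambda>\<omega>. avg K (\<lambda>k. (norm (G (x t k \<omega>)))\<^sup>2))"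
  by (intro integrable_avg integrable_G)

lemma integrable_avg_F: "integrable P (\<lambda>\<omega>. avg K (\<lambda>k. f (x t k \<omega>) - fstar))"
  by (intro integrable_avg integrable_F)

lemma R_eq: "R t = expectation (\<lambda>\<omega>. avg K (\<lambda>k. (norm (x t k \<omega> - m t \<omega>))\<^sup>2))"
  unfolding R_def by (rule integrable_avg(2)[symmetric]) (rule integrable_dev)

lemma A_eq: "A t = expectation (\<lambda>\<omega>. avg K (\<lambda>k. (norm (G (x t k \<omega>)))\<^sup>2))"
  unfolding A_def by (rule integrable_avg(2)[symmetric]) (rule integrable_G)

lemma F_eq: "F t = expectation (\<lambda>\<omega>. avg K (\<lambda>k. f (x t k \<omega>) - fstar))"
  unfolding F_def by (rule integrable_avg(2)[symmetric]) (rule integrable_F)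

section \<open>Quasi-convex case: distance of the averaged iterate to the minimizer\<close>

lemma distance_pointwise:
  assumes qc: "quasi_convex f G fstar \<mu> xs" and \<mu>: "\<mu> \<ge> 0"
  shows "(norm (m t \<omega> - xs - \<gamma> *\<^sub>R h t \<omega>))\<^sup>2 \<le> (1 - \<mu> * \<gamma>) * (norm (m t \<omega> - xs))\<^sup>2
    - 3 / 2 * \<gamma> * avg K (\<lambda>k. f (x t k \<omega>) - fstar)
    + 4 * L * \<gamma> * avg K (\<lambda>k. (norm (x t k \<omega> - m t \<omega>))\<^sup>2)
    + \<gamma>\<^sup>2 * avg K (\<lambda>k. (norm (G (x t k \<omega>)))\<^sup>2)"
proof -
  \<comment> \<open>Quasi-convexity is centred at the query point \<open>y\<close>, but the average
    moves relative to \<open>m\<close>. Replacing \<open>y - xs\<close> by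
    \<open>m t \<omega> - xs\<close> costs a quarter of the suboptimality and \<open>2 * L\<close>
    times the squared deviation.\<close>
  have worker: "3 / 4 * (f y - fstar) + \<mu> / 2 * (norm (y - xs))\<^sup>2 - 2 * L * (norm (y - m t \<omega>))\<^sup>2
      \<le> G y \<bullet> (m t \<omega> - xs)" for y
  proof -
    have "G y \<bullet> (y - m t \<omega>) \<le> norm (G y) * norm (y - m t \<omega>)" by (rule norm_cauchy_schwarz)
    \<comment> \<open>The weight \<open>8 * L\<close> is chosen so that the gradient term becomes
      exactly a quarter of \<open>f y - fstar\<close>.\<close>
    also have "\<dots> \<le> (norm (G y))\<^sup>2 / (8 * L) + 2 * L * (norm (y - m t \<omega>))\<^sup>2"
      using L sum_squares_bound[of "norm (G y)" "4 * L * norm (y - m t \<omega>)"]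
      by (simp add: field_simps power2_eq_square)
    also have "(norm (G y))\<^sup>2 / (8 * L) \<le> (f y - fstar) / 4"
      using smooth_norm_gradient_le[OF smooth L fstar, of y] L by (simp add: field_simps)
    finally have "G y \<bullet> (y - m t \<omega>) \<le> (f y - fstar) / 4 + 2 * L * (norm (y - m t \<omega>))\<^sup>2" by simp
    moreover have "G y \<bullet> (m t \<omega> - xs) = G y \<bullet> (y - xs) - G y \<bullet> (y - m t \<omega>)"
      by (simp add: inner_diff_right)
    moreover have "f y - fstar + \<mu> / 2 * (norm (y - xs))\<^sup>2 \<le> G y \<bullet> (y - xs)"
      using qc by (simp add: quasi_convex_def)
    ultimately show ?thesis by argo
  qed
  \<comment> \<open>By Jensen, the quadratic gain at the single workers dominates the gain at
    \<open>m\<close>, which is the one that can contract the distance.\<close>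
  have "(norm (m t \<omega> - xs))\<^sup>2 \<le> avg K (\<lambda>k. (norm (x t k \<omega> - xs))\<^sup>2)"
    using norm_avg_le[OF K, of "\<lambda>k. x t k \<omega> - xs"] K by (simp add: avg_diff m_def)
  then have "3 / 4 * avg K (\<lambda>k. f (x t k \<omega>) - fstar) + \<mu> / 2 * (norm (m t \<omega> - xs))\<^sup>2
        - 2 * L * avg K (\<lambda>k. (norm (x t k \<omega> - m t \<omega>))\<^sup>2)
      \<le> 3 / 4 * avg K (\<lambda>k. f (x t k \<omega>) - fstar) + \<mu> / 2 * avg K (\<lambda>k. (norm (x t k \<omega> - xs))\<^sup>2)
        - 2 * L * avg K (\<lambda>k. (norm (x t k \<omega> - m t \<omega>))\<^sup>2)"
    using \<mu> by (intro diff_right_mono add_left_mono mult_left_mono) auto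
  also have "\<dots> = avg K (\<lambda>k. 3 / 4 * (f (x t k \<omega>) - fstar) + \<mu> / 2 * (norm (x t k \<omega> - xs))\<^sup>2
        - 2 * L * (norm (x t k \<omega> - m t \<omega>))\<^sup>2)"
    by (simp only: avg_add[where y = "\<lambda>k. \<mu> / 2 * _ k"] avg_diff[where y = "\<lambda>k. 2 * L * _ k"] avg_mult)
  also have "\<dots> \<le> avg K (\<lambda>k. G (x t k \<omega>) \<bullet> (m t \<omega> - xs))"
    by (intro avg_mono worker)
  also have "\<dots> = h t \<omega> \<bullet> (m t \<omega> - xs)" by (simp add: h_def inner_avg_left)
  also have "\<dots> = (m t \<omega> - xs) \<bullet> h t \<omega>" by (rule inner_commute)
  finally have "2 * \<gamma> * (3 / 4 * avg K (\<lambda>k. f (x t k \<omega>) - fstar) + \<mu> / 2 * (norm (m t \<omega> - xs))\<^sup>2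
        - 2 * L * avg K (\<lambda>k. (norm (x t k \<omega> - m t \<omega>))\<^sup>2)) \<le> 2 * \<gamma> * ((m t \<omega> - xs) \<bullet> h t \<omega>)"
    using \<gamma> by (intro mult_left_mono) auto
  moreover have "\<gamma>\<^sup>2 * (norm (h t \<omega>))\<^sup>2 \<le> \<gamma>\<^sup>2 * avg K (\<lambda>k. (norm (G (x t k \<omega>)))\<^sup>2)"
    unfolding h_def by (intro mult_left_mono norm_avg_le[OF K]) auto
  ultimately show ?thesis unfolding norm_diff_scaleR_square by (simp add: algebra_simps)
qed

lemma distance_step:
  assumes qc: "quasi_convex f G fstar \<mu> xs" and \<mu>: "\<mu> \<ge> 0"
  shows "expectation (\<lambda>\<omega>. (norm (m (Suc t) \<omega> - xs))\<^sup>2)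
    \<le> (1 - \<mu> * \<gamma>) * expectation (\<lambda>\<omega>. (norm (m t \<omega> - xs))\<^sup>2) + 4 * L * \<gamma> * R t
      - 13 / 10 * \<gamma> * F t + \<gamma>\<^sup>2 * (\<sigma>\<^sup>2 / K)"
proof -
  let ?y = "\<lambda>\<omega>. m t \<omega> - xs - \<gamma> *\<^sub>R h t \<omega>"
  have sy: "sq_int P ?y"
    by (intro sq_int_diff sq_int_scaleR sq_int_m sq_int_h sq_int_const)
  have my: "?y \<in> borel_measurable (query t)"
    using measurable_m_query measurable_h_query by measurable
  have im: "integrable P (\<lambda>\<omega>. (norm (m t \<omega> - xs))\<^sup>2)" for t
    by (intro sq_int_integrable sq_int_diff sq_int_m sq_int_const)
  have i\<xi>: "integrable P (\<lambda>\<omega>. ?y \<omega> \<bullet> \<xi>m t \<omega>)" by (rule sq_int_inner[OF sy sq_int_\<xi>m])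
  have pw: "(norm (m (Suc t) \<omega> - xs))\<^sup>2 \<le> (1 - \<mu> * \<gamma>) * (norm (m t \<omega> - xs))\<^sup>2
    - 3 / 2 * \<gamma> * avg K (\<lambda>k. f (x t k \<omega>) - fstar)
    + 4 * L * \<gamma> * avg K (\<lambda>k. (norm (x t k \<omega> - m t \<omega>))\<^sup>2)
    + \<gamma>\<^sup>2 * avg K (\<lambda>k. (norm (G (x t k \<omega>)))\<^sup>2)
    - 2 * \<gamma> * (?y \<omega> \<bullet> \<xi>m t \<omega>) + \<gamma>\<^sup>2 * (norm (\<xi>m t \<omega>))\<^sup>2" for \<omega>
  proof -
    have "m (Suc t) \<omega> - xs = ?y \<omega> - \<gamma> *\<^sub>R \<xi>m t \<omega>" by (simp add: m_Suc algebra_simps)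
    then have "(norm (m (Suc t) \<omega> - xs))\<^sup>2
        = (norm (?y \<omega>))\<^sup>2 - 2 * \<gamma> * (?y \<omega> \<bullet> \<xi>m t \<omega>) + \<gamma>\<^sup>2 * (norm (\<xi>m t \<omega>))\<^sup>2"
      by (simp only: norm_diff_scaleR_square[of "?y \<omega>"])
    then show ?thesis using distance_pointwise[OF qc \<mu>, of t \<omega>] by linarith
  qed
  have "expectation (\<lambda>\<omega>. (norm (m (Suc t) \<omega> - xs))\<^sup>2)
    \<le> expectation (\<lambda>\<omega>. (1 - \<mu> * \<gamma>) * (norm (m t \<omega> - xs))\<^sup>2
    - 3 / 2 * \<gamma> * avg K (\<lambda>k. f (x t k \<omega>) - fstar)
    + 4 * L * \<gamma> * avg K (\<lambda>k. (norm (x t k \<omega> - m t \<omega>))\<^sup>2)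
    + \<gamma>\<^sup>2 * avg K (\<lambda>k. (norm (G (x t k \<omega>)))\<^sup>2)
    - 2 * \<gamma> * (?y \<omega> \<bullet> \<xi>m t \<omega>) + \<gamma>\<^sup>2 * (norm (\<xi>m t \<omega>))\<^sup>2)"
    by (rule integral_mono[OF im _ pw])
      (use im i\<xi> integrable_avg_F integrable_avg_dev integrable_avg_G sq_int_integrable[OF sq_int_\<xi>m] in simp)
  also have "\<dots> = (1 - \<mu> * \<gamma>) * expectation (\<lambda>\<omega>. (norm (m t \<omega> - xs))\<^sup>2)
    - 3 / 2 * \<gamma> * F t + 4 * L * \<gamma> * R t + \<gamma>\<^sup>2 * A t + \<gamma>\<^sup>2 * expectation (\<lambda>\<omega>. (norm (\<xi>m t \<omega>))\<^sup>2)"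
    using im i\<xi> integrable_avg_F integrable_avg_dev integrable_avg_G sq_int_integrable[OF sq_int_\<xi>m]
    by (simp add: F_eq A_eq R_eq noise_mean_orthogonal[OF sy my])
  also have "\<dots> \<le> (1 - \<mu> * \<gamma>) * expectation (\<lambda>\<omega>. (norm (m t \<omega> - xs))\<^sup>2)
    - 3 / 2 * \<gamma> * F t + 4 * L * \<gamma> * R t + \<gamma>\<^sup>2 * A t + \<gamma>\<^sup>2 * ((M * A t + \<sigma>\<^sup>2) / K)"
    by (intro add_left_mono mult_left_mono noise_mean_le) auto
  also have "\<dots> = (1 - \<mu> * \<gamma>) * expectation (\<lambda>\<omega>. (norm (m t \<omega> - xs))\<^sup>2)
    - 3 / 2 * \<gamma> * F t + 4 * L * \<gamma> * R t + \<gamma>\<^sup>2 * (1 + M / K) * A t + \<gamma>\<^sup>2 * (\<sigma>\<^sup>2 / K)"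
    by (simp add: algebra_simps add_divide_distrib)
  \<comment> \<open>The second-order gradient terms use up \<open>2 / 10\<close> of the decrease
    \<open>3 / 2\<close>, leaving \<open>13 / 10\<close>.\<close>
  also have "\<gamma>\<^sup>2 * (1 + M / K) * A t \<le> \<gamma>\<^sup>2 * (1 + M / K) * (2 * L * F t)"
    using A_le_F M by (intro mult_left_mono) auto
  also have "\<dots> = 2 * (L * \<gamma> * (1 + M / K)) * (\<gamma> * F t)" by (simp add: power2_eq_square mult_ac)
  also have "\<dots> \<le> 2 / 10 * (\<gamma> * F t)"
    using stepsize_bounds(1) \<gamma> F_nonneg by (intro mult_right_mono) (linarith, simp)
  finally show ?thesis by simp
qed

text \<open>\<open>4 * L * \<gamma>\<close> is the coefficient of \<open>R t\<close> in
  \<open>distance_step\<close>, which is the role of \<open>B\<close> in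
  \<open>potential_step\<close>.\<close>

definition potential_distance :: "'a \<Rightarrow> nat \<Rightarrow> real" where
  "potential_distance xs t = expectation (\<lambda>\<omega>. (norm (m t \<omega> - xs))\<^sup>2)
    + 5 / 2 * (4 * L * \<gamma>) * real (\<tau> - t mod \<tau>) * R t"

lemma potential_distance_nonneg: "potential_distance xs t \<ge> 0"
  unfolding potential_distance_def using L \<gamma> R_nonneg by (intro add_nonneg_nonneg) auto

lemma potential_distance_0: "potential_distance xs 0 = (norm (x0 - xs))\<^sup>2"
  by (simp add: potential_distance_def m_0 R_0 prob_space)

text \<open>Secures the condition on \<rho> in \<open>potential_step\<close>: the potential must not
  be asked to contract faster than the deviation term can follow. It combines
  \<open>\<mu> \<le> 2 * L\<close> with the cap.\<close>

lemma contraction_factor: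
  assumes "quasi_convex f G fstar \<mu> xs"
  shows "1 - \<mu> * \<gamma> / 2 \<ge> 1 - 1 / (10 * real \<tau>)"
proof -
  have "\<mu> * \<gamma> \<le> 2 * L * \<gamma>"
    using quasi_convex_modulus_le[OF smooth L fstar assms] \<gamma> by (intro mult_right_mono)
  moreover have "10 * (L * \<gamma> * \<tau>) \<le> 1"
    using stepsize_bounds(2) K by (simp add: order.trans[OF stepsize_bounds(2)])
  then have "L * \<gamma> \<le> 1 / (10 * real \<tau>)" using \<tau> by (simp add: field_simps)
  ultimately show ?thesis by simp
qed

lemma potential_distance_step:
  assumes qc: "quasi_convex f G fstar \<mu> xs" and \<mu>: "\<mu> \<ge> 0"
  shows "potential_distance xs (Suc t) \<le> (1 - \<mu> * \<gamma> / 2) * potential_distance xs t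
    - 7 / 10 * \<gamma> * F t + 2 * \<gamma>\<^sup>2 * (\<sigma>\<^sup>2 / K)"
proof -
  let ?u = "\<lambda>t. expectation (\<lambda>\<omega>. (norm (m t \<omega> - xs))\<^sup>2)"
  let ?E = "\<lambda>t. \<gamma>\<^sup>2 * ((1 + 2 * \<tau> + M) * A t + \<sigma>\<^sup>2)"
  \<comment> \<open>Half of the contraction is given up here: \<open>\<mu> * \<gamma>\<close> is
    only known to be at most \<open>1 / (5 * \<tau>)\<close>, twice what
    \<open>potential_step\<close> tolerates. This is why the output weights contain
    \<open>\<mu> * \<gamma> / 2\<close>.\<close>
  have "(1 - \<mu> * \<gamma>) * ?u t \<le> (1 - \<mu> * \<gamma> / 2) * ?u t"
    using \<mu> \<gamma> by (intro mult_right_mono Bochner_Integration.integral_nonneg) auto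
  then have "?u (Suc t) \<le> (1 - \<mu> * \<gamma> / 2) * ?u t + 4 * L * \<gamma> * R t - 13 / 10 * \<gamma> * F t
      + \<gamma>\<^sup>2 * (\<sigma>\<^sup>2 / K)"
    using distance_step[OF qc \<mu>, of t] by linarith
  then have "potential_distance xs (Suc t) \<le> (1 - \<mu> * \<gamma> / 2) * potential_distance xs t
      - 13 / 10 * \<gamma> * F t + \<gamma>\<^sup>2 * (\<sigma>\<^sup>2 / K) + 5 / 2 * (4 * L * \<gamma>) * \<tau> * ?E t"
    unfolding potential_distance_def
    using L \<gamma> M A_nonneg
    by (intro potential_step \<tau> contraction_factor[OF qc] R_nonneg R_Suc_le) auto
  also have "5 / 2 * (4 * L * \<gamma>) * \<tau> * ?E t \<le> 6 / 10 * (\<gamma> * F t) + \<gamma>\<^sup>2 * (\<sigma>\<^sup>2 / K)"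
  proof -
    have "5 / 2 * (4 * L * \<gamma>) * \<tau> * ?E t = 10 * (L * \<gamma> * \<tau>) * ?E t" by simp
    also have "\<dots> \<le> 1 / K * ?E t"
      using stepsize_bounds(2) A_nonneg M by (intro mult_right_mono) auto
    also have "\<dots> = \<gamma>\<^sup>2 * (1 + 2 * \<tau> + M) * A t / K + \<gamma>\<^sup>2 * (\<sigma>\<^sup>2 / K)"
      by (simp add: algebra_simps add_divide_distrib)
    \<comment> \<open>The gain \<open>1 / K\<close> matters for the noise only; for the gradient
      part it is discarded, and the cost \<open>6 / 10\<close> lowers the decrease from
      \<open>13 / 10\<close> to \<open>7 / 10\<close>.\<close>
    also have "\<gamma>\<^sup>2 * (1 + 2 * \<tau> + M) * A t / K \<le> \<gamma>\<^sup>2 * (1 + 2 * \<tau> + M) * A t / 1"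
      using K A_nonneg M by (intro divide_left_mono) auto
    also have "\<dots> \<le> \<gamma>\<^sup>2 * (1 + 2 * \<tau> + M) * (2 * L * F t)"
      using A_le_F M by (simp add: mult_left_mono)
    also have "\<dots> = 2 * (L * \<gamma> * (1 + 2 * \<tau> + M)) * (\<gamma> * F t)" by (simp add: power2_eq_square mult_ac)
    also have "\<dots> \<le> 6 / 10 * (\<gamma> * F t)"
      using stepsize_bounds(3) \<gamma> F_nonneg by (intro mult_right_mono) (linarith, simp)
    finally show ?thesis by simp
  qed
  finally show ?thesis by simp
qed

section \<open>General case: descent of the function value at the averaged iterate\<close>

lemma integrable_f_m: "integrable P (\<lambda>\<omega>. f (m t \<omega>))"
  by (rule integrable_f[OF sq_int_m])

text \<open>The descent inequality is applied to one move of \<open>m\<close>. Both terms linear in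
  the noise, from the gradient and from the square, are collected in one inner product whose left
  factor depends on the query points only.\<close>

lemma descent_pointwise:
  "f (m (Suc t) \<omega>) \<le> f (m t \<omega>) - \<gamma> / 2 * avg K (\<lambda>k. (norm (G (x t k \<omega>)))\<^sup>2)
    + L\<^sup>2 * \<gamma> / 2 * avg K (\<lambda>k. (norm (x t k \<omega> - m t \<omega>))\<^sup>2)
    + L * \<gamma>\<^sup>2 / 2 * avg K (\<lambda>k. (norm (G (x t k \<omega>)))\<^sup>2)
    + \<gamma> * (((L * \<gamma>) *\<^sub>R h t \<omega> - G (m t \<omega>)) \<bullet> \<xi>m t \<omega>) + L * \<gamma>\<^sup>2 / 2 * (norm (\<xi>m t \<omega>))\<^sup>2"
proof -
  let ?A = "avg K (\<lambda>k. (norm (G (x t k \<omega>)))\<^sup>2)" and ?R = "avg K (\<lambda>k. (norm (x t k \<omega> - m t \<omega>))\<^sup>2)"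
  \<comment> \<open>Polarisation of \<open>G y \<bullet> G (m t \<omega>)\<close>, with the squared
    gradient at \<open>m\<close> dropped, so the decrease is measured at the workers, where the
    output is drawn.\<close>
  have worker: "1 / 2 * (norm (G y))\<^sup>2 - L\<^sup>2 / 2 * (norm (y - m t \<omega>))\<^sup>2 \<le> G y \<bullet> G (m t \<omega>)" for y
  proof -
    have "(norm (G y - G (m t \<omega>)))\<^sup>2 \<le> L\<^sup>2 * (norm (y - m t \<omega>))\<^sup>2"
      using power_mono[OF lipschitz[of y "m t \<omega>"], of 2] by (simp add: power_mult_distrib)
    moreover have "(norm (G y - G (m t \<omega>)))\<^sup>2 = (norm (G y))\<^sup>2 - 2 * (G y \<bullet> G (m t \<omega>)) + (norm (G (m t \<omega>)))\<^sup>2"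
      using norm_diff_scaleR_square[of "G y" 1 "G (m t \<omega>)"] by simp
    ultimately show ?thesis using zero_le_power2[of "norm (G (m t \<omega>))"] by linarith
  qed
  have "1 / 2 * ?A - L\<^sup>2 / 2 * ?R = avg K (\<lambda>k. 1 / 2 * (norm (G (x t k \<omega>)))\<^sup>2 - L\<^sup>2 / 2 * (norm (x t k \<omega> - m t \<omega>))\<^sup>2)"
    by (simp only: avg_diff avg_mult)
  also have "\<dots> \<le> avg K (\<lambda>k. G (x t k \<omega>) \<bullet> G (m t \<omega>))" by (intro avg_mono worker)
  also have "\<dots> = h t \<omega> \<bullet> G (m t \<omega>)" by (simp add: h_def inner_avg_left)
  also have "\<dots> = G (m t \<omega>) \<bullet> h t \<omega>" by (rule inner_commute)
  finally have 1: "\<gamma> * (1 / 2 * ?A - L\<^sup>2 / 2 * ?R) \<le> \<gamma> * (G (m t \<omega>) \<bullet> h t \<omega>)"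
    using \<gamma> by (intro mult_left_mono)
  have 2: "L * \<gamma>\<^sup>2 / 2 * (norm (h t \<omega>))\<^sup>2 \<le> L * \<gamma>\<^sup>2 / 2 * ?A"
    unfolding h_def using L by (intro mult_left_mono norm_avg_le[OF K]) auto
  have "f (m (Suc t) \<omega>) \<le> f (m t \<omega>) + G (m t \<omega>) \<bullet> (- \<gamma> *\<^sub>R (h t \<omega> + \<xi>m t \<omega>))
      + L / 2 * (norm (- \<gamma> *\<^sub>R (h t \<omega> + \<xi>m t \<omega>)))\<^sup>2"
    using smooth_descent[OF smooth, of "m (Suc t) \<omega>" "m t \<omega>"] by (simp add: m_Suc)
  also have "(norm (- \<gamma> *\<^sub>R (h t \<omega> + \<xi>m t \<omega>)))\<^sup>2
      = \<gamma>\<^sup>2 * ((norm (h t \<omega>))\<^sup>2 + 2 * (h t \<omega> \<bullet> \<xi>m t \<omega>) + (norm (\<xi>m t \<omega>))\<^sup>2)"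
    using norm_diff_scaleR_square[of "h t \<omega>" "-1" "\<xi>m t \<omega>"] by (simp add: power_mult_distrib)
  also have "G (m t \<omega>) \<bullet> (- \<gamma> *\<^sub>R (h t \<omega> + \<xi>m t \<omega>)) = - \<gamma> * (G (m t \<omega>) \<bullet> h t \<omega>) - \<gamma> * (G (m t \<omega>) \<bullet> \<xi>m t \<omega>)"
    by (simp only: inner_scaleR_right inner_add_right) (simp add: algebra_simps)
  moreover have "((L * \<gamma>) *\<^sub>R h t \<omega> - G (m t \<omega>)) \<bullet> \<xi>m t \<omega> = L * \<gamma> * (h t \<omega> \<bullet> \<xi>m t \<omega>) - G (m t \<omega>) \<bullet> \<xi>m t \<omega>"
    by (simp add: inner_diff_left)
  ultimately show ?thesis using 1 2 by (simp add: power2_eq_square[of \<gamma>] algebra_simps)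
qed

lemma descent_step:
  "expectation (\<lambda>\<omega>. f (m (Suc t) \<omega>)) \<le> expectation (\<lambda>\<omega>. f (m t \<omega>)) + L\<^sup>2 * \<gamma> / 2 * R t
    - 9 / 20 * \<gamma> * A t + \<gamma>\<^sup>2 / 2 * (L * \<sigma>\<^sup>2 / K)"
proof -
  let ?y = "\<lambda>\<omega>. (L * \<gamma>) *\<^sub>R h t \<omega> - G (m t \<omega>)"
  have sy: "sq_int P ?y"
    by (intro sq_int_diff sq_int_scaleR sq_int_h sq_int_lipschitz[OF sq_int_m continuous_G lipschitz])
  have my: "?y \<in> borel_measurable (query t)"
    using measurable_m_query measurable_h_query by measurable
  have i\<xi>: "integrable P (\<lambda>\<omega>. ?y \<omega> \<bullet> \<xi>m t \<omega>)" by (rule sq_int_inner[OF sy sq_int_\<xi>m])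
  have "expectation (\<lambda>\<omega>. f (m (Suc t) \<omega>))
    \<le> expectation (\<lambda>\<omega>. f (m t \<omega>) - \<gamma> / 2 * avg K (\<lambda>k. (norm (G (x t k \<omega>)))\<^sup>2)
    + L\<^sup>2 * \<gamma> / 2 * avg K (\<lambda>k. (norm (x t k \<omega> - m t \<omega>))\<^sup>2)
    + L * \<gamma>\<^sup>2 / 2 * avg K (\<lambda>k. (norm (G (x t k \<omega>)))\<^sup>2)
    + \<gamma> * (?y \<omega> \<bullet> \<xi>m t \<omega>) + L * \<gamma>\<^sup>2 / 2 * (norm (\<xi>m t \<omega>))\<^sup>2)"
    by (rule integral_mono[OF integrable_f_m _ descent_pointwise])
      (use i\<xi> integrable_f_m integrable_avg_dev integrable_avg_G sq_int_integrable[OF sq_int_\<xi>m] in simp)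
  also have "\<dots> = expectation (\<lambda>\<omega>. f (m t \<omega>)) - \<gamma> / 2 * A t + L\<^sup>2 * \<gamma> / 2 * R t
      + L * \<gamma>\<^sup>2 / 2 * A t + L * \<gamma>\<^sup>2 / 2 * expectation (\<lambda>\<omega>. (norm (\<xi>m t \<omega>))\<^sup>2)"
    using i\<xi> integrable_f_m integrable_avg_dev integrable_avg_G sq_int_integrable[OF sq_int_\<xi>m]
    by (simp add: A_eq R_eq noise_mean_orthogonal[OF sy my])
  also have "\<dots> \<le> expectation (\<lambda>\<omega>. f (m t \<omega>)) - \<gamma> / 2 * A t + L\<^sup>2 * \<gamma> / 2 * R t
      + L * \<gamma>\<^sup>2 / 2 * A t + L * \<gamma>\<^sup>2 / 2 * ((M * A t + \<sigma>\<^sup>2) / K)"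
    using L by (intro add_left_mono mult_left_mono noise_mean_le) auto
  also have "\<dots> = expectation (\<lambda>\<omega>. f (m t \<omega>)) - \<gamma> / 2 * A t + L\<^sup>2 * \<gamma> / 2 * R t
      + (L * \<gamma> * (1 + M / K)) * (\<gamma> / 2 * A t) + \<gamma>\<^sup>2 / 2 * (L * \<sigma>\<^sup>2 / K)"
    by (simp add: algebra_simps add_divide_distrib power2_eq_square)
  \<comment> \<open>A tenth of \<open>\<gamma> / 2 * A t\<close> is lost, which leaves the
    coefficient \<open>9 / 20\<close>.\<close>
  also have "(L * \<gamma> * (1 + M / K)) * (\<gamma> / 2 * A t) \<le> 1 / 10 * (\<gamma> / 2 * A t)"
    using \<gamma> A_nonneg by (intro mult_right_mono stepsize_bounds(1)) simp
  finally show ?thesis by simp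
qed

text \<open>Same construction with \<open>B = L\<^sup>2 * \<gamma> / 2\<close>, the coefficient of
  \<open>R t\<close> in \<open>descent_step\<close>, and without contraction.\<close>

definition potential_value :: "nat \<Rightarrow> real" where
  "potential_value t = (expectation (\<lambda>\<omega>. f (m t \<omega>)) - fstar)
    + 5 / 2 * (L\<^sup>2 * \<gamma> / 2) * real (\<tau> - t mod \<tau>) * R t"

lemma potential_value_nonneg: "potential_value t \<ge> 0"
proof -
  have "fstar \<le> expectation (\<lambda>\<omega>. f (m t \<omega>))"
    using integral_mono[OF integrable_const integrable_f_m, of fstar] fstar by (simp add: prob_space)
  then show ?thesis unfolding potential_value_def using \<gamma> R_nonneg by (intro add_nonneg_nonneg) auto
qed

lemma potential_value_0: "potential_value 0 = f x0 - fstar"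
  by (simp add: potential_value_def m_0 R_0 prob_space)

lemma potential_value_step:
  "potential_value (Suc t) \<le> potential_value t - 41 / 100 * \<gamma> * A t + 5 / 8 * \<gamma>\<^sup>2 * (L * \<sigma>\<^sup>2 / K)"
proof -
  let ?E = "\<lambda>t. \<gamma>\<^sup>2 * ((1 + 2 * \<tau> + M) * A t + \<sigma>\<^sup>2)"
  have "expectation (\<lambda>\<omega>. f (m (Suc t) \<omega>)) - fstar \<le> 1 * (expectation (\<lambda>\<omega>. f (m t \<omega>)) - fstar)
      + L\<^sup>2 * \<gamma> / 2 * R t - 9 / 20 * \<gamma> * A t + \<gamma>\<^sup>2 / 2 * (L * \<sigma>\<^sup>2 / K)"
    using descent_step[of t] by simp
  then have "potential_value (Suc t) \<le> 1 * potential_value t - 9 / 20 * \<gamma> * A t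
      + \<gamma>\<^sup>2 / 2 * (L * \<sigma>\<^sup>2 / K) + 5 / 2 * (L\<^sup>2 * \<gamma> / 2) * \<tau> * ?E t"
    unfolding potential_value_def
    using L \<gamma> M A_nonneg
    by (intro potential_step \<tau> R_nonneg R_Suc_le) auto
  also have "5 / 2 * (L\<^sup>2 * \<gamma> / 2) * \<tau> * ?E t \<le> 3 / 80 * (\<gamma> * A t) + 1 / 8 * \<gamma>\<^sup>2 * (L * \<sigma>\<^sup>2 / K)"
  proof -
    have "5 / 2 * (L\<^sup>2 * \<gamma> / 2) * \<tau> * ?E t = 10 * (L * \<gamma> * \<tau>) * (L / 8 * ?E t)"
      by (simp add: power2_eq_square)
    also have "\<dots> \<le> 1 / K * (L / 8 * ?E t)"
      using stepsize_bounds(2) A_nonneg M L by (intro mult_right_mono) auto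
    also have "\<dots> = (L * \<gamma> * (1 + 2 * \<tau> + M)) * (\<gamma> * A t) / 8 / K + 1 / 8 * \<gamma>\<^sup>2 * (L * \<sigma>\<^sup>2 / K)"
      by (simp add: algebra_simps add_divide_distrib power2_eq_square)
    also have "(L * \<gamma> * (1 + 2 * \<tau> + M)) * (\<gamma> * A t) / 8 / K
        \<le> (L * \<gamma> * (1 + 2 * \<tau> + M)) * (\<gamma> * A t) / 8 / 1"
      using K A_nonneg M L \<gamma> by (intro divide_left_mono) auto
    also have "\<dots> \<le> 3 / 10 * (\<gamma> * A t) / 8 / 1"
      using \<gamma> A_nonneg by (intro divide_right_mono mult_right_mono stepsize_bounds(3)) simp_all
    finally show ?thesis by simp
  qed
  \<comment> \<open>Needed to round \<open>9 / 20 - 3 / 80 = 33 / 80\<close> down to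
    \<open>41 / 100\<close>.\<close>
  moreover have "0 \<le> \<gamma> * A t" using \<gamma> A_nonneg by simp
  ultimately show ?thesis by (simp add: algebra_simps)
qed

section \<open>Law of the output and convergence rates\<close>

lemma x_stationary:
  assumes "\<gamma> = 0"
  shows "x t k \<omega> = x0"
  unfolding x_def unfolding assms using K by (rule local_sgd_stepsize_0)


text \<open>The index weights are normalised over all pairs, with total \<open>K\<close> times the
  sum of the \<open>w t\<close>; this \<open>K\<close> becomes the average over workers.\<close>

lemma output_expectation:
  fixes g :: "'a \<Rightarrow> real" and T :: nat
  assumes w: "\<And>t. w t > 0"
    and g: "\<And>t k. k \<in> {1..K} \<Longrightarrow> integrable P (\<lambda>\<omega>. g (x t k \<omega>))"
  defines "Out \<equiv> P \<Otimes>\<^sub>M weighted_index T K w"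
  shows "integrable Out (\<lambda>z. g (sgd_output G x0 \<gamma> \<tau> K \<xi> z))"
    and "(\<integral>z. g (sgd_output G x0 \<gamma> \<tau> K \<xi> z) \<partial>Out)
      = (\<Sum>t<T. w t * avg K (\<lambda>k. expectation (\<lambda>\<omega>. g (x t k \<omega>)))) / (\<Sum>t<T. w t)"
proof -
  define S where "S = {..<T} \<times> {1..K}"
  define p where "p i = w (fst i) / (\<Sum>(s, j)\<in>S. w s)" for i :: "nat \<times> nat"
  have Out: "Out = P \<Otimes>\<^sub>M point_measure S (\<lambda>i. ennreal (p i))"
    by (simp add: Out_def weighted_index_def S_def p_def case_prod_unfold)
  have eq: "sgd_output G x0 \<gamma> \<tau> K \<xi> (\<omega>, i) = x (fst i) (snd i) \<omega>" for \<omega> i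
    by (simp add: sgd_output_def x_def case_prod_beta)
  have int: "integrable P (\<lambda>\<omega>. g (sgd_output G x0 \<gamma> \<tau> K \<xi> (\<omega>, i)))" if "i \<in> S" for i
    using g that by (auto simp: eq S_def)
  have fin: "finite S" by (simp add: S_def)
  have p: "0 \<le> p i" for i
    unfolding p_def using w by (intro divide_nonneg_nonneg sum_nonneg) (auto intro: less_imp_le)
  show "integrable Out (\<lambda>z. g (sgd_output G x0 \<gamma> \<tau> K \<xi> z))"
    unfolding Out by (rule integral_pair_point_measure(1)[OF fin p int])
  have W: "(\<Sum>(s, j)\<in>S. w s) = K * (\<Sum>t<T. w t)"
    by (simp add: S_def sum.cartesian_product[symmetric] sum_distrib_left)
  have "(\<integral>z. g (sgd_output G x0 \<gamma> \<tau> K \<xi> z) \<partial>Out)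
      = (\<Sum>i\<in>S. p i * expectation (\<lambda>\<omega>. g (sgd_output G x0 \<gamma> \<tau> K \<xi> (\<omega>, i))))"
    unfolding Out by (rule integral_pair_point_measure(2)[OF fin p int])
  also have "\<dots> = (\<Sum>t<T. \<Sum>k=1..K. w t / (K * (\<Sum>t<T. w t)) * expectation (\<lambda>\<omega>. g (x t k \<omega>)))"
    unfolding eq p_def W by (simp add: S_def sum.cartesian_product case_prod_beta)
  also have "\<dots> = (\<Sum>t<T. w t * avg K (\<lambda>k. expectation (\<lambda>\<omega>. g (x t k \<omega>)))) / (\<Sum>t<T. w t)"
    by (simp add: avg_def sum_distrib_left sum_divide_distrib mult_ac)
  finally show "(\<integral>z. g (sgd_output G x0 \<gamma> \<tau> K \<xi> z) \<partial>Out)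
      = (\<Sum>t<T. w t * avg K (\<lambda>k. expectation (\<lambda>\<omega>. g (x t k \<omega>)))) / (\<Sum>t<T. w t)" .
qed

lemma output_f:
  assumes w: "\<And>t. w t > 0" and T: "T \<ge> 1"
  defines "Out \<equiv> P \<Otimes>\<^sub>M weighted_index T K w"
  shows "integrable Out (\<lambda>z. f (sgd_output G x0 \<gamma> \<tau> K \<xi> z))"
    and "(\<integral>z. f (sgd_output G x0 \<gamma> \<tau> K \<xi> z) \<partial>Out) - fstar = (\<Sum>t<T. w t * F t) / (\<Sum>t<T. w t)"
proof -
  have i: "integrable P (\<lambda>\<omega>. f (x t k \<omega>))" if "k \<in> {1..K}" for t k
    by (rule integrable_f[OF sq_int_x[OF that]])
  show "integrable Out (\<lambda>z. f (sgd_output G x0 \<gamma> \<tau> K \<xi> z))"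
    unfolding Out_def using w i by (rule output_expectation(1))
  have "avg K (\<lambda>k. expectation (\<lambda>\<omega>. f (x t k \<omega>))) = avg K (\<lambda>k. expectation (\<lambda>\<omega>. f (x t k \<omega>) - fstar) + fstar)" for t
    using i by (intro avg_cong) (simp add: prob_space)
  then have F: "avg K (\<lambda>k. expectation (\<lambda>\<omega>. f (x t k \<omega>))) = F t + fstar" for t
    using K by (simp add: avg_add F_def)
  have "(\<Sum>t<T. w t) > 0" using w T by (intro sum_pos) (auto simp: lessThan_empty_iff)
  then have "(\<Sum>t<T. w t * (F t + fstar)) / (\<Sum>t<T. w t) = (\<Sum>t<T. w t * F t) / (\<Sum>t<T. w t) + fstar"
    by (simp add: distrib_left sum.distrib sum_distrib_right[symmetric] add_divide_distrib)
  moreover have "(\<integral>z. f (sgd_output G x0 \<gamma> \<tau> K \<xi> z) \<partial>Out) = (\<Sum>t<T. w t * (F t + fstar)) / (\<Sum>t<T. w t)"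
    unfolding Out_def F[symmetric] using w i by (rule output_expectation(2))
  ultimately show "(\<integral>z. f (sgd_output G x0 \<gamma> \<tau> K \<xi> z) \<partial>Out) - fstar = (\<Sum>t<T. w t * F t) / (\<Sum>t<T. w t)"
    by simp
qed


lemma quasi_convex_rate:
  assumes qc: "quasi_convex f G fstar \<mu> xs" and \<mu>: "\<mu> > 0" and \<gamma>0: "\<gamma> > 0" and T: "T \<ge> 1"
  defines "Out \<equiv> P \<Otimes>\<^sub>M weighted_index T K (\<lambda>t. (1 - \<mu> * \<gamma> / 2) powi (- int t))"
  shows "integrable Out (\<lambda>z. f (sgd_output G x0 \<gamma> \<tau> K \<xi> z))"
    and "(\<integral>z. f (sgd_output G x0 \<gamma> \<tau> K \<xi> z) \<partial>Out) - fstar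
      \<le> 10 / 7 * ((norm (x0 - xs))\<^sup>2 / \<gamma> * exp (- (\<mu> / 2) * \<gamma> * T) + 2 * (\<sigma>\<^sup>2 / K * \<gamma>))"
proof -
  let ?\<rho> = "1 - \<mu> * \<gamma> / 2"
  \<comment> \<open>Positivity of \<rho> makes its negative powers legitimate weights.\<close>
  have "1 / (10 * real \<tau>) < 1" using \<tau> by (simp add: field_simps)
  then have \<rho>: "0 < ?\<rho>" "?\<rho> \<le> 1" using contraction_factor[OF qc] \<mu> \<gamma>0 by (linarith, simp)
  have w: "?\<rho> powi (- int t) > 0" for t using \<rho> by simp
  show "integrable Out (\<lambda>z. f (sgd_output G x0 \<gamma> \<tau> K \<xi> z))"
    unfolding Out_def using w T by (rule output_f(1))
  have "(\<integral>z. f (sgd_output G x0 \<gamma> \<tau> K \<xi> z) \<partial>Out) - fstar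
      = (\<Sum>t<T. ?\<rho> powi (- int t) * F t) / (\<Sum>t<T. ?\<rho> powi (- int t))"
    unfolding Out_def using w T by (rule output_f(2))
  also have "\<dots> \<le> (potential_distance xs 0 * exp (- (1 - ?\<rho>) * T) + 2 * \<gamma>\<^sup>2 * (\<sigma>\<^sup>2 / K)) / (7 / 10 * \<gamma>)"
    using \<rho> \<gamma>0 \<mu>
    by (intro weighted_average_bound potential_distance_nonneg T potential_distance_step[OF qc]) auto
  also have "\<dots> = 10 / 7 * ((norm (x0 - xs))\<^sup>2 / \<gamma> * exp (- (\<mu> / 2) * \<gamma> * T) + 2 * (\<sigma>\<^sup>2 / K * \<gamma>))"
    using \<gamma>0 by (simp add: potential_distance_0 field_simps power2_eq_square[of \<gamma>])
  finally show "(\<integral>z. f (sgd_output G x0 \<gamma> \<tau> K \<xi> z) \<partial>Out) - fstar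
      \<le> 10 / 7 * ((norm (x0 - xs))\<^sup>2 / \<gamma> * exp (- (\<mu> / 2) * \<gamma> * T) + 2 * (\<sigma>\<^sup>2 / K * \<gamma>))" .
qed

lemma convex_rate:
  assumes qc: "quasi_convex f G fstar 0 xs" and T: "T \<ge> 1"
    and \<gamma>0: "\<gamma> = 0 \<Longrightarrow> x0 = xs"
  defines "Out \<equiv> P \<Otimes>\<^sub>M uniform_index T K"
  shows "integrable Out (\<lambda>z. f (sgd_output G x0 \<gamma> \<tau> K \<xi> z))"
    and "(\<integral>z. f (sgd_output G x0 \<gamma> \<tau> K \<xi> z) \<partial>Out) - fstar
      \<le> 10 / 7 * ((norm (x0 - xs))\<^sup>2 / (\<gamma> * T) + 2 * (\<sigma>\<^sup>2 / K * \<gamma>))"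
proof -
  show "integrable Out (\<lambda>z. f (sgd_output G x0 \<gamma> \<tau> K \<xi> z))"
    unfolding Out_def uniform_index_weighted using T by (intro output_f(1)) simp
  have out: "(\<integral>z. f (sgd_output G x0 \<gamma> \<tau> K \<xi> z) \<partial>Out) - fstar = (\<Sum>t<T. F t) / T"
    unfolding Out_def uniform_index_weighted using output_f(2)[of "\<lambda>_. 1", OF _ T] by simp
  show "(\<integral>z. f (sgd_output G x0 \<gamma> \<tau> K \<xi> z) \<partial>Out) - fstar
      \<le> 10 / 7 * ((norm (x0 - xs))\<^sup>2 / (\<gamma> * T) + 2 * (\<sigma>\<^sup>2 / K * \<gamma>))"
  proof (cases "\<gamma> = 0")
    case True
    \<comment> \<open>With stepsize zero the run stays at \<open>x0 = xs\<close>, a minimizer, so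
      the left side is zero; the right side is also zero, because of division by zero.\<close>
    have "f xs \<le> fstar" using qc[unfolded quasi_convex_def, rule_format, of xs] by simp
    then have "f x0 = fstar" using \<gamma>0[OF True] fstar[of xs] by simp
    then have "F t = 0" for t unfolding F_def using x_stationary[OF True] by (simp add: avg_def)
    then show ?thesis using True unfolding out by simp
  next
    case False
    then have \<gamma>pos: "\<gamma> > 0" using \<gamma> by simp
    \<comment> \<open>Without contraction the weighted bound is used with \<open>\<rho> = 1\<close>,
      written as a power of one to match its statement.\<close>
    have "7 / 10 * \<gamma> * (\<Sum>t<T. 1 powi (- int t) * F t)
        \<le> 1 * potential_distance xs 0 + 2 * \<gamma>\<^sup>2 * (\<sigma>\<^sup>2 / K) * (\<Sum>t<T. 1 powi (- int t))"
      using potential_distance_step[OF qc]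
      by (intro weighted_sum_bound potential_distance_nonneg) auto
    then have "7 / 10 * \<gamma> * (\<Sum>t<T. F t) \<le> (norm (x0 - xs))\<^sup>2 + 2 * \<gamma>\<^sup>2 * (\<sigma>\<^sup>2 / K) * T"
      by (simp add: potential_distance_0)
    then have "7 / 10 * \<gamma> * (\<Sum>t<T. F t) / (7 / 10 * \<gamma> * T)
        \<le> ((norm (x0 - xs))\<^sup>2 + 2 * \<gamma>\<^sup>2 * (\<sigma>\<^sup>2 / K) * T) / (7 / 10 * \<gamma> * T)"
      using \<gamma>pos by (intro divide_right_mono) auto
    moreover have "7 / 10 * \<gamma> * (\<Sum>t<T. F t) / (7 / 10 * \<gamma> * T) = (\<Sum>t<T. F t) / T"
      using \<gamma>pos by simp
    moreover have "((norm (x0 - xs))\<^sup>2 + 2 * \<gamma>\<^sup>2 * (\<sigma>\<^sup>2 / K) * T) / (7 / 10 * \<gamma> * T)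
        = 10 / 7 * ((norm (x0 - xs))\<^sup>2 / (\<gamma> * T) + 2 * (\<sigma>\<^sup>2 / K * \<gamma>))"
      using \<gamma>pos T by (simp add: field_simps power2_eq_square[of \<gamma>])
    ultimately show ?thesis unfolding out by linarith
  qed
qed

lemma nonconvex_rate:
  assumes T: "T \<ge> 1" and \<gamma>0: "\<gamma> = 0 \<Longrightarrow> f x0 = fstar"
  defines "Out \<equiv> P \<Otimes>\<^sub>M uniform_index T K"
  shows "integrable Out (\<lambda>z. (norm (G (sgd_output G x0 \<gamma> \<tau> K \<xi> z)))\<^sup>2)"
    and "(\<integral>z. (norm (G (sgd_output G x0 \<gamma> \<tau> K \<xi> z)))\<^sup>2 \<partial>Out)
      \<le> 100 / 41 * ((f x0 - fstar) / (\<gamma> * T) + 5 / 8 * (L * \<sigma>\<^sup>2 / K * \<gamma>))"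
proof -
  show "integrable Out (\<lambda>z. (norm (G (sgd_output G x0 \<gamma> \<tau> K \<xi> z)))\<^sup>2)"
    unfolding Out_def uniform_index_weighted
    using integrable_G by (intro output_expectation(1)[where g = "\<lambda>y. (norm (G y))\<^sup>2"]) simp_all
  have out: "(\<integral>z. (norm (G (sgd_output G x0 \<gamma> \<tau> K \<xi> z)))\<^sup>2 \<partial>Out) = (\<Sum>t<T. A t) / T"
    unfolding Out_def uniform_index_weighted A_def
    using output_expectation(2)[where g = "\<lambda>y. (norm (G y))\<^sup>2" and w = "\<lambda>_. 1" and T = T, OF _ integrable_G]
    by simp
  show "(\<integral>z. (norm (G (sgd_output G x0 \<gamma> \<tau> K \<xi> z)))\<^sup>2 \<partial>Out)
      \<le> 100 / 41 * ((f x0 - fstar) / (\<gamma> * T) + 5 / 8 * (L * \<sigma>\<^sup>2 / K * \<gamma>))"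
  proof (cases "\<gamma> = 0")
    case True
    \<comment> \<open>With stepsize zero the run stays at a minimizer, where the gradient
      vanishes.\<close>
    have "G x0 = 0" using smooth_norm_gradient_le[OF smooth L fstar, of x0] \<gamma>0[OF True] by simp
    then have "A t = 0" for t unfolding A_def using x_stationary[OF True] by (simp add: avg_def)
    then show ?thesis using True unfolding out by simp
  next
    case False
    then have \<gamma>pos: "\<gamma> > 0" using \<gamma> by simp
    have "41 / 100 * \<gamma> * (\<Sum>t<T. 1 powi (- int t) * A t)
        \<le> 1 * potential_value 0 + 5 / 8 * \<gamma>\<^sup>2 * (L * \<sigma>\<^sup>2 / K) * (\<Sum>t<T. 1 powi (- int t))"
      using potential_value_step by (intro weighted_sum_bound potential_value_nonneg) auto
    then have "41 / 100 * \<gamma> * (\<Sum>t<T. A t) \<le> (f x0 - fstar) + 5 / 8 * \<gamma>\<^sup>2 * (L * \<sigma>\<^sup>2 / K) * T"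
      by (simp add: potential_value_0)
    then have "41 / 100 * \<gamma> * (\<Sum>t<T. A t) / (41 / 100 * \<gamma> * T)
        \<le> ((f x0 - fstar) + 5 / 8 * \<gamma>\<^sup>2 * (L * \<sigma>\<^sup>2 / K) * T) / (41 / 100 * \<gamma> * T)"
      using \<gamma>pos by (intro divide_right_mono) auto
    moreover have "41 / 100 * \<gamma> * (\<Sum>t<T. A t) / (41 / 100 * \<gamma> * T) = (\<Sum>t<T. A t) / T"
      using \<gamma>pos by simp
    moreover have "((f x0 - fstar) + 5 / 8 * \<gamma>\<^sup>2 * (L * \<sigma>\<^sup>2 / K) * T) / (41 / 100 * \<gamma> * T)
        = 100 / 41 * ((f x0 - fstar) / (\<gamma> * T) + 5 / 8 * (L * \<sigma>\<^sup>2 / K * \<gamma>))"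
      using \<gamma>pos T by (simp add: field_simps power2_eq_square[of \<gamma>])
    ultimately show ?thesis unfolding out by linarith
  qed
qed

end

text \<open>Each stepsize is fixed before the probability space and the noise, hence works for all
  of them. Rules A and B are used with the unspecified constant factors equal to one, and 100 is a
  generous common constant. In the first part the log factor is the explicit content of the tilde,
  and the exponent is \<open>a * T / d\<close> with \<open>a = \<mu> / 2\<close>, the rate at which
  the potential contracts.\<close>

theorem theorem24:
  fixes f :: "'a::euclidean_space \<Rightarrow> real" and G :: "'a \<Rightarrow> 'a" and x0 :: 'a
    and L M \<sigma> fstar :: real and K \<tau> T :: nat
  assumes "L > 0" and "L_smooth f G L" and "is_min_value f fstar"
    and "K \<ge> 1" and "\<tau> \<ge> 1" and "M \<ge> 0" and "\<sigma> \<ge> 0" and "T \<ge> 1"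
  shows
    "(\<forall>(\<mu>::real) xstar. \<mu> > 0 \<and> quasi_convex f G fstar \<mu> xstar \<longrightarrow>
       (\<exists>\<gamma>. 0 < \<gamma> \<and> \<gamma> \<le> 1 / (10 * L * (\<tau> * K + M)) \<and>
          \<gamma> = stepsize_A (10 * L * (\<tau> * K + M)) (\<mu> / 2) ((norm (x0 - xstar))\<^sup>2) (\<sigma>\<^sup>2 / K) T \<and>
          (\<forall>(P :: 'w measure) \<xi>. local_sgd_noise P G M \<sigma> x0 \<gamma> \<tau> K \<xi> \<longrightarrow>
             (let Out = P \<Otimes>\<^sub>M weighted_index T K (\<lambda>t. (1 - \<mu> * \<gamma> / 2) powi (- int t));
                  xout = sgd_output G x0 \<gamma> \<tau> K \<xi>
              in integrable Out (\<lambda>z. f (xout z)) \<and>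
                 (\<integral>z. f (xout z) \<partial>Out) - fstar \<le>
                   100 * (L * (\<tau> * K + M) * (norm (x0 - xstar))\<^sup>2
                            * exp (- ((\<mu> / 2) * T / (10 * L * (\<tau> * K + M))))
                          + log_factor (\<mu> / 2) ((norm (x0 - xstar))\<^sup>2) (\<sigma>\<^sup>2 / K) T
                            * (\<sigma>\<^sup>2 / (\<mu> * K * T))))))) \<and>
     (\<forall>xstar. quasi_convex f G fstar 0 xstar \<longrightarrow>
       (\<exists>\<gamma>. 0 \<le> \<gamma> \<and> \<gamma> \<le> 1 / (10 * L * (\<tau> * K + M)) \<and>
          \<gamma> = stepsize_B (10 * L * (\<tau> * K + M)) ((norm (x0 - xstar))\<^sup>2) (\<sigma>\<^sup>2 / K) T \<and>
          (\<forall>(P :: 'w measure) \<xi>. local_sgd_noise P G M \<sigma> x0 \<gamma> \<tau> K \<xi> \<longrightarrow>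
             (let Out = P \<Otimes>\<^sub>M uniform_index T K;
                  xout = sgd_output G x0 \<gamma> \<tau> K \<xi>
              in integrable Out (\<lambda>z. f (xout z)) \<and>
                 (\<integral>z. f (xout z) \<partial>Out) - fstar \<le>
                   100 * (L * (\<tau> * K + M) * (norm (x0 - xstar))\<^sup>2 / T
                          + \<sigma> * norm (x0 - xstar) / sqrt (K * T)))))) \<and>
     (\<exists>\<gamma>. 0 \<le> \<gamma> \<and> \<gamma> \<le> 1 / (10 * L * (\<tau> * K + M)) \<and>
          \<gamma> = stepsize_B (10 * L * (\<tau> * K + M)) (f x0 - fstar) (L * \<sigma>\<^sup>2 / K) T \<and>
          (\<forall>(P :: 'w measure) \<xi>. local_sgd_noise P G M \<sigma> x0 \<gamma> \<tau> K \<xi> \<longrightarrow>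
             (let Out = P \<Otimes>\<^sub>M uniform_index T K;
                  xout = sgd_output G x0 \<gamma> \<tau> K \<xi>
              in integrable Out (\<lambda>z. (norm (G (xout z)))\<^sup>2) \<and>
                 (\<integral>z. (norm (G (xout z)))\<^sup>2 \<partial>Out) \<le>
                   100 * (L * (\<tau> * K + M) * (f x0 - fstar) / T
                          + \<sigma> * sqrt (L * (f x0 - fstar) / (K * T))))))"
proof -
  have fstar: "fstar \<le> f y" for y using \<open>is_min_value f fstar\<close> by (simp add: is_min_value_def)
  define d where "d = 10 * L * (\<tau> * K + M)"
  have "\<tau> * K \<ge> 1" using \<open>K \<ge> 1\<close> \<open>\<tau> \<ge> 1\<close> by simp
  then have "real (\<tau> * K) + M > 0" using \<open>M \<ge> 0\<close> by linarith
  then have d: "d > 0" using \<open>L > 0\<close> unfolding d_def by (intro mult_pos_pos) simp_all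
  have run: "sgd_run P f G x0 L M \<sigma> fstar \<gamma> K \<tau> \<xi>"
    if "0 \<le> \<gamma>" "\<gamma> \<le> 1 / d" "local_sgd_noise P G M \<sigma> x0 \<gamma> \<tau> K \<xi>"
    for P :: "'w measure" and \<xi> \<gamma>
  proof -
    have "\<gamma> * d \<le> 1" using that(2) d by (simp add: field_simps)
    then have "10 * (L * \<gamma> * (\<tau> * K + M)) \<le> 1" by (simp add: d_def mult_ac)
    then show ?thesis
      using that assms fstar
      by (simp add: sgd_run_def sgd_run_axioms_def local_sgd_noise_def)
  qed
  have part1: "\<exists>\<gamma>. 0 < \<gamma> \<and> \<gamma> \<le> 1 / d \<and>
      \<gamma> = stepsize_A d (\<mu> / 2) ((norm (x0 - xs))\<^sup>2) (\<sigma>\<^sup>2 / K) T \<and>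
      (\<forall>(P :: 'w measure) \<xi>. local_sgd_noise P G M \<sigma> x0 \<gamma> \<tau> K \<xi> \<longrightarrow>
         (let Out = P \<Otimes>\<^sub>M weighted_index T K (\<lambda>t. (1 - \<mu> * \<gamma> / 2) powi (- int t));
              xout = sgd_output G x0 \<gamma> \<tau> K \<xi>
          in integrable Out (\<lambda>z. f (xout z)) \<and>
             (\<integral>z. f (xout z) \<partial>Out) - fstar \<le>
               100 * (L * (\<tau> * K + M) * (norm (x0 - xs))\<^sup>2 * exp (- ((\<mu> / 2) * T / d))
                      + log_factor (\<mu> / 2) ((norm (x0 - xs))\<^sup>2) (\<sigma>\<^sup>2 / K) T * (\<sigma>\<^sup>2 / (\<mu> * K * T)))))"
    if \<mu>: "\<mu> > 0" and qc: "quasi_convex f G fstar \<mu> xs" for \<mu> :: real and xs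
  proof -
    let ?r = "(norm (x0 - xs))\<^sup>2" and ?c = "\<sigma>\<^sup>2 / K"
    let ?e = "L * (\<tau> * K + M) * ?r * exp (- ((\<mu> / 2) * T / d))"
    let ?l = "log_factor (\<mu> / 2) ?r ?c T"
    define \<gamma> where "\<gamma> = stepsize_A d (\<mu> / 2) ?r ?c T"
    have \<mu>2: "0 < \<mu> / 2" using \<mu> by simp
    note b = stepsize_A_bounds[OF d \<mu>2 zero_le_power2[of "norm (x0 - xs)"] _ \<open>T \<ge> 1\<close>, of ?c, folded \<gamma>_def]
    have \<gamma>b: "0 < \<gamma>" "\<gamma> \<le> 1 / d" using b(1,2) by auto
    have bound: "10 / 7 * (?r / \<gamma> * exp (- (\<mu> / 2) * \<gamma> * T) + 2 * (?c * \<gamma>))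
        \<le> 100 * (?e + ?l * (\<sigma>\<^sup>2 / (\<mu> * K * T)))"
    proof -
      \<comment> \<open>Rule A is used with the rate \<open>\<mu> / 2\<close>, which doubles the
        noise term.\<close>
      have "?c / (\<mu> / 2 * T) = 2 * (\<sigma>\<^sup>2 / (\<mu> * K * T))" by (simp add: mult_ac)
      then have 1: "?c * \<gamma> \<le> 2 * (?l * (\<sigma>\<^sup>2 / (\<mu> * K * T)))"
        and 2: "?r / \<gamma> * exp (- (\<mu> / 2) * \<gamma> * T) \<le> d * ?r * exp (- ((\<mu> / 2) * T / d))
          + 9 / 4 * (2 * (?l * (\<sigma>\<^sup>2 / (\<mu> * K * T))))"
        using b(3,4) by (simp_all add: mult_ac)
      have 3: "d * ?r * exp (- ((\<mu> / 2) * T / d)) = 10 * ?e" by (simp add: d_def)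
      have "0 \<le> ?e" using \<open>L > 0\<close> \<open>M \<ge> 0\<close> by (intro mult_nonneg_nonneg) auto
      moreover have "0 \<le> ?l * (\<sigma>\<^sup>2 / (\<mu> * K * T))"
        using \<mu> by (intro mult_nonneg_nonneg divide_nonneg_nonneg) (auto simp: log_factor_def)
      ultimately show ?thesis using 1 2 3 by argo
    qed
    have "let Out = P \<Otimes>\<^sub>M weighted_index T K (\<lambda>t. (1 - \<mu> * \<gamma> / 2) powi (- int t));
              xout = sgd_output G x0 \<gamma> \<tau> K \<xi>
          in integrable Out (\<lambda>z. f (xout z)) \<and>
             (\<integral>z. f (xout z) \<partial>Out) - fstar \<le> 100 * (?e + ?l * (\<sigma>\<^sup>2 / (\<mu> * K * T)))"
      if noise: "local_sgd_noise P G M \<sigma> x0 \<gamma> \<tau> K \<xi>" for P :: "'w measure" and \<xi>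
    proof -
      interpret sgd_run P f G x0 L M \<sigma> fstar \<gamma> K \<tau> \<xi>
        using run[OF less_imp_le[OF \<gamma>b(1)] \<gamma>b(2) noise] .
      show ?thesis
        using quasi_convex_rate[OF qc \<mu> \<gamma>b(1) \<open>T \<ge> 1\<close>] bound
        unfolding Let_def by (auto intro: order_trans)
    qed
    then show ?thesis using \<gamma>b by (intro exI[of _ \<gamma>] conjI allI impI \<gamma>_def) auto
  qed
  have part2: "\<exists>\<gamma>. 0 \<le> \<gamma> \<and> \<gamma> \<le> 1 / d \<and>
      \<gamma> = stepsize_B d ((norm (x0 - xs))\<^sup>2) (\<sigma>\<^sup>2 / K) T \<and>
      (\<forall>(P :: 'w measure) \<xi>. local_sgd_noise P G M \<sigma> x0 \<gamma> \<tau> K \<xi> \<longrightarrow>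
         (let Out = P \<Otimes>\<^sub>M uniform_index T K;
              xout = sgd_output G x0 \<gamma> \<tau> K \<xi>
          in integrable Out (\<lambda>z. f (xout z)) \<and>
             (\<integral>z. f (xout z) \<partial>Out) - fstar \<le>
               100 * (L * (\<tau> * K + M) * (norm (x0 - xs))\<^sup>2 / T
                      + \<sigma> * norm (x0 - xs) / sqrt (K * T))))"
    if qc: "quasi_convex f G fstar 0 xs" for xs
  proof -
    let ?r = "(norm (x0 - xs))\<^sup>2" and ?c = "\<sigma>\<^sup>2 / K"
    let ?e = "L * (\<tau> * K + M) * ?r / T" and ?s = "\<sigma> * norm (x0 - xs) / sqrt (K * T)"
    define \<gamma> where "\<gamma> = stepsize_B d ?r ?c T"
    note b = stepsize_B_bounds[OF d zero_le_power2[of "norm (x0 - xs)"] _ \<open>T \<ge> 1\<close>, of ?c, folded \<gamma>_def]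
    have \<gamma>b: "0 \<le> \<gamma>" "\<gamma> \<le> 1 / d" "\<gamma> = 0 \<Longrightarrow> x0 = xs" using b(1-3) by auto
    have bound: "10 / 7 * (?r / (\<gamma> * T) + 2 * (?c * \<gamma>)) \<le> 100 * (?e + ?s)"
    proof -
      have "sqrt (?r * ?c / T) = ?s"
        using \<open>\<sigma> \<ge> 0\<close> by (simp add: real_sqrt_divide real_sqrt_mult)
      then have 1: "?c * \<gamma> \<le> ?s" and 2: "?r / (\<gamma> * T) \<le> d * ?r / T + ?s"
        using b(4,5) by simp_all
      have 3: "d * ?r / T = 10 * ?e" by (simp add: d_def)
      have "0 \<le> ?e" using \<open>L > 0\<close> \<open>M \<ge> 0\<close> by (intro divide_nonneg_nonneg mult_nonneg_nonneg) auto
      moreover have "0 \<le> ?s" using \<open>\<sigma> \<ge> 0\<close> by simp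
      ultimately show ?thesis using 1 2 3 by argo
    qed
    have "let Out = P \<Otimes>\<^sub>M uniform_index T K; xout = sgd_output G x0 \<gamma> \<tau> K \<xi>
          in integrable Out (\<lambda>z. f (xout z)) \<and>
             (\<integral>z. f (xout z) \<partial>Out) - fstar \<le> 100 * (?e + ?s)"
      if noise: "local_sgd_noise P G M \<sigma> x0 \<gamma> \<tau> K \<xi>" for P :: "'w measure" and \<xi>
    proof -
      interpret sgd_run P f G x0 L M \<sigma> fstar \<gamma> K \<tau> \<xi>
        using run[OF \<gamma>b(1,2) noise] .
      show ?thesis
        using convex_rate[OF qc \<open>T \<ge> 1\<close> \<gamma>b(3)] bound
        unfolding Let_def by (auto intro: order_trans)
    qed
    then show ?thesis using \<gamma>b(1,2) by (intro exI[of _ \<gamma>] conjI allI impI \<gamma>_def) auto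
  qed
  have part3: "\<exists>\<gamma>. 0 \<le> \<gamma> \<and> \<gamma> \<le> 1 / d \<and>
      \<gamma> = stepsize_B d (f x0 - fstar) (L * \<sigma>\<^sup>2 / K) T \<and>
      (\<forall>(P :: 'w measure) \<xi>. local_sgd_noise P G M \<sigma> x0 \<gamma> \<tau> K \<xi> \<longrightarrow>
         (let Out = P \<Otimes>\<^sub>M uniform_index T K;
              xout = sgd_output G x0 \<gamma> \<tau> K \<xi>
          in integrable Out (\<lambda>z. (norm (G (xout z)))\<^sup>2) \<and>
             (\<integral>z. (norm (G (xout z)))\<^sup>2 \<partial>Out) \<le>
               100 * (L * (\<tau> * K + M) * (f x0 - fstar) / T
                      + \<sigma> * sqrt (L * (f x0 - fstar) / (K * T)))))"
  proof -
    let ?r = "f x0 - fstar" and ?c = "L * \<sigma>\<^sup>2 / K"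
    let ?e = "L * (\<tau> * K + M) * ?r / T" and ?s = "\<sigma> * sqrt (L * ?r / (K * T))"
    define \<gamma> where "\<gamma> = stepsize_B d ?r ?c T"
    have r: "?r \<ge> 0" using fstar by simp
    have c: "?c \<ge> 0" using \<open>L > 0\<close> by simp
    note b = stepsize_B_bounds[OF d r c \<open>T \<ge> 1\<close>, folded \<gamma>_def]
    have \<gamma>b: "0 \<le> \<gamma>" "\<gamma> \<le> 1 / d" "\<gamma> = 0 \<Longrightarrow> f x0 = fstar" using b(1-3) by auto
    have bound: "100 / 41 * (?r / (\<gamma> * T) + 5 / 8 * (?c * \<gamma>)) \<le> 100 * (?e + ?s)"
    proof -
      have "?r * ?c / T = \<sigma>\<^sup>2 * (L * ?r / (K * T))" by simp
      then have "sqrt (?r * ?c / T) = ?s"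
        using \<open>\<sigma> \<ge> 0\<close> by (simp only: real_sqrt_mult real_sqrt_unique)
      then have 1: "?c * \<gamma> \<le> ?s" and 2: "?r / (\<gamma> * T) \<le> d * ?r / T + ?s"
        using b(4,5) by simp_all
      have 3: "d * ?r / T = 10 * ?e" by (simp add: d_def)
      have "0 \<le> ?e"
        using \<open>L > 0\<close> \<open>M \<ge> 0\<close> r by (intro divide_nonneg_nonneg mult_nonneg_nonneg) auto
      moreover have "0 \<le> ?s" using \<open>\<sigma> \<ge> 0\<close> \<open>L > 0\<close> r by simp
      ultimately show ?thesis using 1 2 3 by argo
    qed
    have "let Out = P \<Otimes>\<^sub>M uniform_index T K; xout = sgd_output G x0 \<gamma> \<tau> K \<xi>
          in integrable Out (\<lambda>z. (norm (G (xout z)))\<^sup>2) \<and>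
             (\<integral>z. (norm (G (xout z)))\<^sup>2 \<partial>Out) \<le> 100 * (?e + ?s)"
      if noise: "local_sgd_noise P G M \<sigma> x0 \<gamma> \<tau> K \<xi>" for P :: "'w measure" and \<xi>
    proof -
      interpret sgd_run P f G x0 L M \<sigma> fstar \<gamma> K \<tau> \<xi>
        using run[OF \<gamma>b(1,2) noise] .
      show ?thesis
        using nonconvex_rate[OF \<open>T \<ge> 1\<close> \<gamma>b(3)] bound
        unfolding Let_def by (auto intro: order_trans)
    qed
    then show ?thesis using \<gamma>b(1,2) by (intro exI[of _ \<gamma>] conjI allI impI \<gamma>_def) auto
  qed
  show ?thesis
    using part1 part2 part3 unfolding d_def by (intro conjI allI impI) blast+
qed

end
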